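(* Assume the standing setup below. If $\beta_n n^{-\alpha}\to\infty$ as $n\to\infty$, then $A_{(1)}\to 1$ in probability and, for every fixed integer $i\ge 2$, $A_{(i)}\to 0$ in probability.
   Context: Standing setup: Fix an integer $d\ge 2$; let $\mathbb S^{d-1}\subset\mathbb R^d$ be the unit sphere with surface measure $\sigma$. Fix $q\in\mathbb S^{d-1}$. Let $x_1,x_2,\dots$ be i.i.d. random vectors on $\mathbb S^{d-1}$ with law $\rho(x)\,d\sigma(x)$, where $\rho$ is a $C^2$ probability density on $\mathbb S^{d-1}$ with $\rho(q)>0$. Let $(\beta_n)_{n\ge1}$ be positive reals and set $\alpha=2/(d-1)$. Define $T_i=1-\langle q,x_i\rangle\in[0,2]$, $Z_n=\sum_{j=1}^n e^{-\beta_nT_j}$, attention weights $A_i=e^{-\beta_nT_i}/Z_n$ ($1\le i\le n$), and let $A_{(1)}\ge A_{(2)}\ge\cdots\ge A_{(n)}$ be their decreasing rearrangement. *)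

theory Defs
  imports "HOL-Probability.Probability"
begin

text \<open>Surface measure on the unit sphere of a Euclidean space, defined as the cone measure:
  sigma(A) = d * Lebesgue volume of {t x : x in A, 0 < t <= 1}, i.e. the push-forward of
  d times Lebesgue measure on the closed unit ball under the radial projection y to y/|y|.\<close>
definition sphere_measure :: "('a::euclidean_space) measure" where
  "sphere_measure =
     distr (density lborel (\<lambda>y. of_nat DIM('a) * indicator (cball 0 1) y)) borel
           (\<lambda>y. y /\<^sub>R norm y)"

definition C2_on :: "'a::euclidean_space set \<Rightarrow> ('a \<Rightarrow> real) \<Rightarrow> bool" where
  "C2_on S f \<longleftrightarrow>
     (\<exists>U g g' g''. open U \<and> S \<subseteq> U \<and> (\<forall>x\<in>S. g x = f x) \<and>
        (\<forall>x\<in>U. (g has_derivative blinfun_apply (g' x)) (at x)) \<and>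
        (\<forall>x\<in>U. (g' has_derivative blinfun_apply (g'' x)) (at x)) \<and>
        continuous_on U g'')"

definition Tval :: "'a::real_inner \<Rightarrow> (nat \<Rightarrow> 'm \<Rightarrow> 'a) \<Rightarrow> nat \<Rightarrow> 'm \<Rightarrow> real" where
  "Tval q X i \<omega> = 1 - inner q (X i \<omega>)"

definition Zval :: "(nat \<Rightarrow> real) \<Rightarrow> 'a::real_inner \<Rightarrow> (nat \<Rightarrow> 'm \<Rightarrow> 'a) \<Rightarrow> nat \<Rightarrow> 'm \<Rightarrow> real" where
  "Zval \<beta> q X n \<omega> = (\<Sum>j=1..n. exp (- \<beta> n * Tval q X j \<omega>))"

definition Aval :: "(nat \<Rightarrow> real) \<Rightarrow> 'a::real_inner \<Rightarrow> (nat \<Rightarrow> 'm \<Rightarrow> 'a) \<Rightarrow> nat \<Rightarrow> nat \<Rightarrow> 'm \<Rightarrow> real" where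
  "Aval \<beta> q X n i \<omega> = exp (- \<beta> n * Tval q X i \<omega>) / Zval \<beta> q X n \<omega>"

definition Aord :: "(nat \<Rightarrow> real) \<Rightarrow> 'a::real_inner \<Rightarrow> (nat \<Rightarrow> 'm \<Rightarrow> 'a) \<Rightarrow> nat \<Rightarrow> nat \<Rightarrow> 'm \<Rightarrow> real" where
  "Aord \<beta> q X n i \<omega> = rev (sort (map (\<lambda>j. Aval \<beta> q X n j \<omega>) [1..<n+1])) ! (i - 1)"

definition conv_in_prob :: "'m measure \<Rightarrow> (nat \<Rightarrow> 'm \<Rightarrow> real) \<Rightarrow> real \<Rightarrow> bool" where
  "conv_in_prob M Y c \<longleftrightarrow>
     (\<forall>\<epsilon>>0. (\<lambda>n. measure M {\<omega> \<in> space M. \<bar>Y n \<omega> - c\<bar> > \<epsilon>}) \<longlonglongrightarrow> 0)"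

end

theory Submission
  imports Defs "HOL-Real_Asymp.Real_Asymp"
begin

text \<open>The law of \<open>T = 1 - q \<bullet> x\<close> has a distribution function asymptotic to \<open>c * t powr m\<close> at \<open>0\<close>,
  with \<open>m = (d - 1) / 2 = 1 / \<alpha>\<close>. Hence the smallest among \<open>n\<close> samples of \<open>T\<close> and its gaps to the
  others live on the scale \<open>n powr (- \<alpha>)\<close>, and \<open>\<beta> n\<close> resolves this scale: relative to the minimal
  sample all other exponentials add up to a quantity tending to \<open>0\<close> in probability. The cap volumes
  come from the scaling of a solid cone under the linear maps that dilate \<open>q\<close> and its orthogonal
  complement by different factors.\<close>

section \<open>Samples from a law with a power-law distribution function at zero\<close>

text \<open>The obstacle is to separate the smallest sample from all others at once. For large
  \<open>d\<close> a union bound over unrestricted near ties fails: about \<open>n\<close> squared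
  pairs are too many for gaps of order \<open>r\<close>. Requiring one partner to lie below
  \<open>2 * K * r\<close> costs a factor of order \<open>1 / n\<close>, and by independence the
  other partner falls into a window around it with probability of order \<open>1 / n\<close> again.
  The second constant can be made arbitrarily small through the window width, which dictates the
  order of choices: \<open>K\<close>, then \<open>\<eta>\<close> depending on \<open>K\<close>, then
  \<open>n\<close>. Windows are measured by increments of the distribution function, because for
  \<open>d = 2\<close> the density of \<open>T\<close> is unbounded at \<open>0\<close>; the error
  in the power law is itself small compared with \<open>r powr m\<close>. Samples outside this range
  are too many for a pointwise bound, as \<open>\<beta> n * r n\<close> may grow arbitrarily slowly.
  Their weight is controlled in expectation: \<open>n\<close> times the Laplace transform at
  \<open>\<beta> n / 2\<close> is of order \<open>(\<beta> n * r n) powr (- m)\<close>.\<close>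

locale power_law_at_zero = real_distribution N for N :: "real measure" +
  fixes m c :: real
  assumes m_pos: "m > 0" and c_pos: "c > 0"
    and cdf_asymp: "((\<lambda>t. cdf N t / t powr m) \<longlongrightarrow> c) (at_right 0)"
begin

text \<open>The quotient stays bounded while \<open>t powr m\<close> tends to \<open>0\<close>, so
  right continuity leaves no mass on the nonpositive half-line.\<close>

lemma cdf_0: "cdf N 0 = 0"
proof -
  have "((\<lambda>t. cdf N t / t powr m * t powr m) \<longlongrightarrow> c * 0) (at_right 0)"
  proof (intro tendsto_mult cdf_asymp)
    show "((\<lambda>t::real. t powr m) \<longlongrightarrow> 0) (at_right 0)"
      using m_pos by real_asymp
  qed
  then have "(cdf N \<longlongrightarrow> c * 0) (at_right 0)"
    by (rule Lim_transform_eventually) (auto simp: eventually_at_filter)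
  moreover have "(cdf N \<longlongrightarrow> cdf N 0) (at_right 0)"
    using cdf_is_right_cont[of 0] by (simp add: continuous_within)
  ultimately show ?thesis
    using tendsto_unique[of "at_right (0::real)"] by fastforce
qed

lemma cdf_nonpos: "t \<le> 0 \<Longrightarrow> cdf N t = 0"
  using cdf_0 cdf_nondecreasing[of t 0] cdf_nonneg[of t] by simp

lemma AE_pos: "AE t in N. t > 0"
proof -
  have "emeasure N {..0} = 0"
    using cdf_0 by (simp add: cdf_def emeasure_eq_measure)
  then show ?thesis
    by (intro AE_I[of _ _ "{..0}"]) auto
qed

text \<open>Including \<open>t = 0\<close>, where both terms vanish because
  \<open>0 powr m = 0\<close>, permits clipping arguments at zero later on.\<close>

lemma cdf_approx:
  assumes "e > 0"
  obtains t0 where "t0 > 0" "\<And>t. \<lbrakk>0 \<le> t; t < t0\<rbrakk> \<Longrightarrow> \<bar>cdf N t - c * t powr m\<bar> \<le> e * t powr m"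
proof -
  have "eventually (\<lambda>t. dist (cdf N t / t powr m) c < e) (at_right 0)"
    using cdf_asymp assms by (rule tendstoD)
  then obtain t0 where t0: "t0 > 0" "\<And>t. 0 < t \<Longrightarrow> t < t0 \<Longrightarrow> \<bar>cdf N t / t powr m - c\<bar> < e"
    unfolding eventually_at_right_field dist_real_def by auto
  have "\<bar>cdf N t - c * t powr m\<bar> \<le> e * t powr m" if t: "0 \<le> t" "t < t0" for t
  proof (cases "t = 0")
    case True
    then show ?thesis by (simp add: cdf_0)
  next
    case False
    have "\<bar>cdf N t - c * t powr m\<bar> = \<bar>cdf N t / t powr m - c\<bar> * t powr m"
      using False t by (simp add: field_simps abs_mult flip: abs_mult_pos)
    also have "\<dots> \<le> e * t powr m"
      using t0(2)[of t] t False by (intro mult_right_mono) auto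
    finally show ?thesis .
  qed
  with t0(1) that show ?thesis by blast
qed

lemma cdf_upper_bound: obtains C where "C > 0" "\<And>t. t > 0 \<Longrightarrow> cdf N t \<le> C * t powr m"
proof -
  obtain t0 where t0: "t0 > 0" "\<And>t. \<lbrakk>0 \<le> t; t < t0\<rbrakk> \<Longrightarrow> \<bar>cdf N t - c * t powr m\<bar> \<le> c * t powr m"
    using cdf_approx c_pos by blast
  \<comment> \<open>The summand \<open>2 * c\<close> serves \<open>t < t0\<close>; the summand
    \<open>t0 powr (-m)\<close> serves \<open>t \<ge> t0\<close>, where
    \<open>1 \<le> (t / t0) powr m\<close>.\<close>
  define C where "C = 2 * c + t0 powr (-m)"
  have "cdf N t \<le> C * t powr m" if "t > 0" for t
  proof (cases "t < t0")
    case True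
    then have "cdf N t \<le> 2 * c * t powr m"
      using t0(2)[of t] that by simp
    also have "\<dots> \<le> C * t powr m"
      by (intro mult_right_mono) (auto simp: C_def)
    finally show ?thesis .
  next
    case False
    have "cdf N t \<le> 1" by (rule cdf_bounded_prob)
    also have "\<dots> \<le> (t / t0) powr m"
      using False t0 m_pos by (intro ge_one_powr_ge_zero) auto
    also have "\<dots> = t0 powr (-m) * t powr m"
      using that t0 by (simp add: powr_divide powr_minus field_simps)
    also have "\<dots> \<le> C * t powr m"
      using c_pos by (intro mult_right_mono) (auto simp: C_def)
    finally show ?thesis .
  qed
  moreover have "C > 0" using c_pos by (simp add: C_def add_pos_nonneg)
  ultimately show ?thesis using that by blast
qed

text \<open>The integral is dominated by slicing the half-line into intervals of length \<open>1 / \<gamma>\<close>.\<close>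
lemma laplace_transform_bound:
  obtains C where "C \<ge> 0"
    "\<And>\<gamma>. \<gamma> > 0 \<Longrightarrow> (\<integral>\<^sup>+t. ennreal (exp (- (\<gamma> * t))) \<partial>N) \<le> ennreal (C * \<gamma> powr (- m))"
proof -
  obtain C0 where C0: "C0 > 0" "\<And>t. t > 0 \<Longrightarrow> cdf N t \<le> C0 * t powr m"
    using cdf_upper_bound by blast
  \<comment> \<open>The bound for slice \<open>k\<close> with the common factor
    \<open>C0 * \<gamma> powr (-m)\<close> removed; exponential decay beats the polynomial
    growth.\<close>
  define a where "a k = exp (- real k) * (real k + 1) powr m" for k
  have a_nonneg: "a k \<ge> 0" for k by (simp add: a_def)
  have summ: "summable a"
  proof (rule summable_comparison_test_bigo)
    show "summable (\<lambda>n. norm (1 / real n ^ 2))"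
      using inverse_power_summable[of 2, where ?'a = real] by (simp add: field_simps)
    show "a \<in> O(\<lambda>n. 1 / real n ^ 2)" unfolding a_def by real_asymp
  qed
  define C where "C = C0 * suminf a"
  have "(\<integral>\<^sup>+t. ennreal (exp (- (\<gamma> * t))) \<partial>N) \<le> ennreal (C * \<gamma> powr (- m))" if g: "\<gamma> > 0" for \<gamma>
  proof -
    \<comment> \<open>The indicator covers everything up to the right end of slice \<open>k\<close>,
      not only the slice, so that each term integrates to a single value of the distribution
      function.\<close>
    define b where "b k t = ennreal (exp (- real k)) * indicator {..(real k + 1) / \<gamma>} t" for k t
    have [measurable]: "b k \<in> borel_measurable N" for k
      unfolding b_def by measurable
    have "(\<integral>\<^sup>+t. ennreal (exp (- (\<gamma> * t))) \<partial>N) \<le> (\<integral>\<^sup>+t. (\<Sum>k. b k t) \<partial>N)"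
    proof (intro nn_integral_mono_AE, use AE_pos in eventually_elim)
      case (elim t)
      define k where "k = nat \<lfloor>\<gamma> * t\<rfloor>"
      have k: "real k \<le> \<gamma> * t" "\<gamma> * t \<le> real k + 1"
        using elim g by (auto simp: k_def)
      have "ennreal (exp (- (\<gamma> * t))) \<le> b k t"
        using k g by (auto simp: b_def field_simps indicator_def intro!: ennreal_leI)
      also have "\<dots> \<le> (\<Sum>k. b k t)"
        using sum_le_suminf[of "\<lambda>k. b k t" "{k}"] by simp
      finally show ?case .
    qed
    also have "\<dots> = (\<Sum>k. \<integral>\<^sup>+t. b k t \<partial>N)"
      by (intro nn_integral_suminf) auto
    also have "\<dots> = (\<Sum>k. ennreal (exp (- real k) * cdf N ((real k + 1) / \<gamma>)))"
      unfolding b_def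
      by (subst nn_integral_cmult_indicator) (auto simp: emeasure_eq_measure cdf_def ennreal_mult)
    also have "\<dots> \<le> (\<Sum>k. ennreal (C0 * \<gamma> powr (-m) * a k))"
    proof (intro suminf_le summableI ennreal_leI)
      fix k
      have "exp (- real k) * cdf N ((real k + 1) / \<gamma>) \<le> exp (- real k) * (C0 * ((real k + 1) / \<gamma>) powr m)"
        using g by (intro mult_left_mono C0) auto
      also have "\<dots> = C0 * \<gamma> powr (-m) * a k"
        using g by (simp add: a_def powr_divide powr_minus field_simps)
      finally show "exp (- real k) * cdf N ((real k + 1) / \<gamma>) \<le> C0 * \<gamma> powr (-m) * a k" .
    qed
    also have "\<dots> = ennreal (C0 * \<gamma> powr (-m) * suminf a)"
      using a_nonneg C0 summ
      by (subst suminf_ennreal_eq[of _ "C0 * \<gamma> powr (-m) * suminf a"]) (auto intro!: sums_mult)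
    finally show ?thesis by (simp add: C_def mult_ac)
  qed
  moreover have "C \<ge> 0" using C0 suminf_nonneg[OF summ a_nonneg] by (simp add: C_def)
  ultimately show ?thesis using that by blast
qed

text \<open>After division by \<open>r\<close> the window has endpoints in a fixed compact interval,
  and its mass is \<open>r powr m\<close> times an increment of \<open>c * x powr m\<close> up to a
  small error. Uniform continuity of \<open>x powr m\<close> makes the increment small; a derivative
  bound would fail near \<open>0\<close> for \<open>m < 1\<close>.\<close>

lemma window_bound:
  assumes L: "L > 0" and k: "\<kappa> > 0"
  obtains \<eta> r0 where "\<eta> > 0" "r0 > 0"
    "\<And>r s. \<lbrakk>0 < r; r < r0; s \<le> L * r\<rbrakk> \<Longrightarrow> prob {s - \<eta> * r..s + \<eta> * r} \<le> \<kappa> * r powr m"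
proof -
  have "continuous_on {0..L + 1} (\<lambda>x::real. x powr m)"
    using m_pos by (intro continuous_on_powr') (auto intro!: continuous_intros)
  then have "uniformly_continuous_on {0..L + 1} (\<lambda>x::real. x powr m)"
    by (rule compact_uniformly_continuous) auto
  moreover have "\<kappa> / (2 * c) > 0" using k c_pos by simp
  ultimately obtain \<delta> where \<delta>: "\<delta> > 0"
    "\<And>x y. \<lbrakk>x \<in> {0..L+1}; y \<in> {0..L+1}; \<bar>x - y\<bar> < \<delta>\<rbrakk> \<Longrightarrow> \<bar>x powr m - y powr m\<bar> < \<kappa> / (2 * c)"
    unfolding uniformly_continuous_on_def dist_real_def by metis
  \<comment> \<open>The enlarged window below has rescaled length at most \<open>3 * \<eta>\<close>,
    which is less than \<open>\<delta>\<close>; the cap at \<open>1\<close> keeps its right end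
    below \<open>L + 1\<close>.\<close>
  define \<eta> where "\<eta> = min 1 (\<delta> / 4)"
  have \<eta>: "\<eta> > 0" "\<eta> \<le> 1" "3 * \<eta> < \<delta>" using \<delta> by (auto simp: \<eta>_def min_def)
  \<comment> \<open>Each of the two endpoints then contributes an error of at most
    \<open>\<kappa> / 4 * r powr m\<close>, leaving half of \<open>\<kappa>\<close> for the
    increment itself.\<close>
  define e where "e = \<kappa> / (4 * (L + 1) powr m)"
  have e: "e > 0" "e * (L + 1) powr m = \<kappa> / 4" using L k by (auto simp: e_def)
  obtain t0 where t0: "t0 > 0" "\<And>t. \<lbrakk>0 \<le> t; t < t0\<rbrakk> \<Longrightarrow> \<bar>cdf N t - c * t powr m\<bar> \<le> e * t powr m"
    using cdf_approx e by blast
  define r0 where "r0 = t0 / (L + 1)"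
  have "prob {s - \<eta> * r..s + \<eta> * r} \<le> \<kappa> * r powr m" if r: "0 < r" "r < r0" and s: "s \<le> L * r" for r s
  proof -
    \<comment> \<open>Clipping at zero changes no value of the distribution function, which vanishes
      on the nonpositive half-line.\<close>
    define x where "x = max 0 (s / r + \<eta>)"
    define y where "y = max 0 (s / r - 2 * \<eta>)"
    have sr: "s / r \<le> L" using r s by (simp add: field_simps)
    have xy: "x \<in> {0..L+1}" "y \<in> {0..L+1}" "\<bar>x - y\<bar> < \<delta>"
      using sr \<eta> L by (auto simp: x_def y_def max_def abs_if)
    have approx: "\<bar>cdf N (z * r) - c * (z powr m * r powr m)\<bar> \<le> \<kappa> * r powr m / 4" if z: "z \<in> {0..L+1}" for z
    proof -
      have "z * r \<le> (L + 1) * r" using z r by (intro mult_right_mono) auto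
      also have "\<dots> < t0" using r L by (simp add: r0_def field_simps)
      finally have "\<bar>cdf N (z * r) - c * (z * r) powr m\<bar> \<le> e * (z * r) powr m"
        using z r by (intro t0) auto
      also have "\<dots> \<le> e * ((L + 1) * r) powr m"
        using z r e m_pos by (intro mult_left_mono powr_mono2 mult_right_mono) auto
      also have "\<dots> = \<kappa> * r powr m / 4"
        using r L e by (simp add: powr_mult)
      finally show ?thesis using z r by (simp add: powr_mult)
    qed
    have cdf_max: "cdf N u = cdf N (max 0 (u / r) * r)" for u
      using r cdf_nonpos[of u] by (cases "u \<ge> 0") (auto simp: max_def cdf_0 field_simps)
    \<comment> \<open>Differences of distribution functions measure intervals open on the left;
      moving the left end further out absorbs a possible atom at
      \<open>s - \<eta> * r\<close>.\<close>
    have "prob {s - \<eta> * r..s + \<eta> * r} \<le> prob {s - 2 * \<eta> * r<..s + \<eta> * r}"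
      using mult_pos_pos[OF \<eta>(1) r(1)] by (intro finite_measure_mono) auto
    also have "\<dots> = cdf N (s + \<eta> * r) - cdf N (s - 2 * \<eta> * r)"
      using \<eta> r by (subst cdf_diff_eq) (auto intro: add_pos_pos)
    also have "\<dots> = cdf N (x * r) - cdf N (y * r)"
      using cdf_max[of "s + \<eta> * r"] cdf_max[of "s - 2 * \<eta> * r"] r
      by (simp add: x_def y_def add_divide_distrib diff_divide_distrib)
    also have "\<dots> \<le> c * ((x powr m - y powr m) * r powr m) + \<kappa> * r powr m / 2"
      using abs_le_D1[OF approx[OF xy(1)]] abs_le_D2[OF approx[OF xy(2)]]
      by (simp add: left_diff_distrib right_diff_distrib)
    also have "\<dots> \<le> c * (\<kappa> / (2 * c) * r powr m) + \<kappa> * r powr m / 2"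
      using \<delta>(2)[OF xy] c_pos by (intro add_mono mult_left_mono mult_right_mono) auto
    also have "\<dots> = \<kappa> * r powr m" using c_pos by simp
    finally show ?thesis .
  qed
  moreover have "r0 > 0" using t0 L by (simp add: r0_def)
  ultimately show ?thesis using that \<eta> by blast
qed

end


section \<open>Near ties and minima of independent samples\<close>

context prob_space
begin

lemma indep_vars_imp_indep_var:
  assumes "indep_vars M' X I" "i \<in> I" "j \<in> I" "i \<noteq> j"
  shows "indep_var (M' i) (X i) (M' j) (X j)"
proof -
  have "indep_var (M' i) ((\<lambda>f. f i) \<circ> (\<lambda>\<omega>. restrict (\<lambda>i. X i \<omega>) {i}))
      (M' j) ((\<lambda>f. f j) \<circ> (\<lambda>\<omega>. restrict (\<lambda>i. X i \<omega>) {j}))"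
    using assms by (intro indep_var_compose[OF indep_var_restrict[OF assms(1)]]) auto
  then show ?thesis by (simp add: comp_def)
qed

text \<open>By independence the joint law is a product, so Fubini fixes \<open>S = s\<close> first
  and leaves \<open>T\<close> a window around \<open>s\<close>. Keeping the factor
  \<open>cdf N a\<close> is essential: both factors will be of order \<open>1 / n\<close>.\<close>

lemma prob_near_tie_le:
  fixes S T :: "'a \<Rightarrow> real"
  assumes indep: "indep_var borel S borel T"
    and law: "distr M borel S = N" "distr M borel T = N"
    and p: "\<And>s. s \<le> a \<Longrightarrow> measure N {s - h..s + h} \<le> p" "p \<ge> 0"
  shows "prob {\<omega> \<in> space M. S \<omega> \<le> a \<and> \<bar>T \<omega> - S \<omega>\<bar> \<le> h} \<le> cdf N a * p"
proof -
  have [measurable]: "random_variable borel S" "random_variable borel T"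
    using indep by (auto dest: indep_var_rv1 indep_var_rv2)
  interpret N: prob_space N
    unfolding law(1)[symmetric] by (rule prob_space_distr) simp
  have [measurable_cong]: "sets N = sets borel" by (simp flip: law(1))
  have joint: "N \<Otimes>\<^sub>M N = distr M (borel \<Otimes>\<^sub>M borel) (\<lambda>\<omega>. (S \<omega>, T \<omega>))"
    using indep law unfolding indep_var_distribution_eq by simp
  define D where "D = {z :: real \<times> real. fst z \<le> a \<and> \<bar>snd z - fst z\<bar> \<le> h}"
  have D: "D \<in> sets (borel \<Otimes>\<^sub>M borel)"
  proof -
    have "{z \<in> space (borel \<Otimes>\<^sub>M borel). fst z \<le> a \<and> \<bar>snd z - fst z\<bar> \<le> h} \<in> sets (borel \<Otimes>\<^sub>M (borel :: real measure))"
      by measurable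
    then show ?thesis by (simp add: D_def space_pair_measure)
  qed
  have "emeasure M {\<omega> \<in> space M. S \<omega> \<le> a \<and> \<bar>T \<omega> - S \<omega>\<bar> \<le> h} = emeasure (N \<Otimes>\<^sub>M N) D"
    unfolding joint using D by (subst emeasure_distr) (auto simp: D_def intro!: arg_cong[where f = "emeasure M"])
  also have "\<dots> = (\<integral>\<^sup>+s. emeasure N (Pair s -` D) \<partial>N)"
    using D by (intro N.emeasure_pair_measure_alt) (simp cong: sets_pair_measure_cong)
  also have "\<dots> \<le> (\<integral>\<^sup>+s. ennreal p * indicator {..a} s \<partial>N)"
  proof (intro nn_integral_mono)
    fix s
    have "Pair s -` D = (if s \<le> a then {s - h..s + h} else {})"
      by (auto simp: D_def)
    then show "emeasure N (Pair s -` D) \<le> ennreal p * indicator {..a} s"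
      using p(1)[of s] by (auto simp: N.emeasure_eq_measure intro!: ennreal_leI)
  qed
  also have "\<dots> = ennreal (cdf N a * p)"
    using p(2) by (subst nn_integral_cmult_indicator)
      (auto simp: N.emeasure_eq_measure cdf_def mult.commute simp flip: ennreal_mult)
  finally show ?thesis
    using p(2) by (simp add: emeasure_eq_measure cdf_def)
qed

lemma prob_all_greater_le:
  fixes T :: "nat \<Rightarrow> 'a \<Rightarrow> real"
  assumes indep: "indep_vars (\<lambda>_. borel) T {1..}"
    and law: "\<And>i. i \<ge> 1 \<Longrightarrow> distr M borel (T i) = N"
  shows "prob {\<omega> \<in> space M. \<forall>i\<in>{1..n}. T i \<omega> > a} \<le> exp (- (real n * cdf N a))"
\<comment> \<open>For \<open>n = 0\<close> the event is all of \<open>space M\<close> and the bound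
  is \<open>1\<close>; the product formula is applied to a nonempty family of events.\<close>
proof (cases "n = 0")
  case False
  have rv: "random_variable borel (T i)" if "i \<ge> 1" for i
    using indep that by (auto simp: indep_vars_def)
  have "prob (T i -` {a<..} \<inter> space M) = 1 - cdf N a" if "i \<ge> 1" for i
  proof -
    have "prob (T i -` {a<..} \<inter> space M) = prob (space M - (T i -` {..a} \<inter> space M))"
      by (intro arg_cong[where f = prob]) auto
    also have "\<dots> = 1 - prob (T i -` {..a} \<inter> space M)"
      using rv[OF that] by (intro prob_compl) (auto intro: measurable_sets)
    also have "prob (T i -` {..a} \<inter> space M) = cdf N a"
      unfolding cdf_def law[OF that, symmetric] using rv[OF that] by (subst measure_distr) auto
    finally show ?thesis .
  qed
  moreover have "{\<omega> \<in> space M. \<forall>i\<in>{1..n}. T i \<omega> > a} = (\<Inter>i\<in>{1..n}. T i -` {a<..} \<inter> space M)"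
    using False by auto
  moreover have "prob (\<Inter>i\<in>{1..n}. T i -` {a<..} \<inter> space M) = (\<Prod>i\<in>{1..n}. prob (T i -` {a<..} \<inter> space M))"
    using False by (intro indep_varsD[OF indep]) auto
  ultimately have "prob {\<omega> \<in> space M. \<forall>i\<in>{1..n}. T i \<omega> > a} = (1 - cdf N a) ^ n"
    by simp
  also have "\<dots> \<le> exp (- cdf N a) ^ n"
  proof (rule power_mono)
    show "1 - cdf N a \<le> exp (- cdf N a)"
      using exp_ge_add_one_self[of "- cdf N a"] by simp
    show "0 \<le> 1 - cdf N a"
      using prob_le_1[of "T 1 -` {..a} \<inter> space M"] rv[of 1]
      unfolding cdf_def law[of 1, simplified, symmetric] by (subst measure_distr) auto
  qed
  also have "\<dots> = exp (- (real n * cdf N a))"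
    by (simp flip: exp_of_nat_mult)
  finally show ?thesis .
qed simp

end

text \<open>With \<open>r = n powr (- 1 / m)\<close>, the smallest \<open>T\<close> is at most \<open>K * r\<close>, and no two values below
  \<open>2 * K * r\<close> are within \<open>\<eta> * r\<close> of each other. A competitor above \<open>2 * K * r\<close> loses at least half of
  its own value against the minimum, so the sum \<open>W\<close> below dominates all competitors.\<close>
proposition (in prob_space) power_law_single_dominant_term:
  fixes T :: "nat \<Rightarrow> 'a \<Rightarrow> real" and \<beta> :: "nat \<Rightarrow> real"
  assumes pl: "power_law_at_zero N m c"
    and indep: "indep_vars (\<lambda>_. borel) T {1..}"
    and law: "\<And>i. i \<ge> 1 \<Longrightarrow> distr M borel (T i) = N"
    and beta: "\<And>n. n \<ge> 1 \<Longrightarrow> \<beta> n > 0"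
    and lim: "filterlim (\<lambda>n. \<beta> n * real n powr (- (1 / m))) at_top sequentially"
    and eps: "\<epsilon> > 0" and delta: "\<delta> > 0"
  shows "\<forall>\<^sub>F n in sequentially. \<exists>B\<in>events. prob B \<le> 3 * \<delta> \<and>
           (\<forall>\<omega>\<in>space M - B. \<exists>k\<in>{1..n}. (\<Sum>j\<in>{1..n}-{k}. exp (- (\<beta> n * (T j \<omega> - T k \<omega>)))) < \<epsilon>)"
proof -
  interpret P: power_law_at_zero N m c by (rule pl)
  note m = P.m_pos and c = P.c_pos
  have rv: "random_variable borel (T i)" if "i \<ge> 1" for i
    using indep that by (auto simp: indep_vars_def)
  define r where "r n = real n powr (- (1 / m))" for n
  have r_pos: "r n > 0" if "n \<ge> 1" for n using that by (simp add: r_def)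
  have r_m: "r n powr m = 1 / real n" if "n \<ge> 1" for n
  proof -
    have "r n powr m = real n powr (- 1)"
      unfolding r_def powr_powr using m by simp
    then show ?thesis using that by (simp add: powr_minus_divide)
  qed
  have r_lim: "filterlim r (at_right 0) sequentially"
    unfolding r_def using m by real_asymp

  obtain C0 where C0: "C0 > 0" "\<And>t. t > 0 \<Longrightarrow> cdf N t \<le> C0 * t powr m"
    using P.cdf_upper_bound by blast
  obtain C1 where C1: "C1 \<ge> 0"
    "\<And>\<gamma>. \<gamma> > 0 \<Longrightarrow> (\<integral>\<^sup>+t. ennreal (exp (- (\<gamma> * t))) \<partial>N) \<le> ennreal (C1 * \<gamma> powr (- m))"
    using P.laplace_transform_bound by blast
  \<comment> \<open>This exponential bounds the probability that all samples exceed
    \<open>K * r n\<close>: for large \<open>n\<close>, \<open>cdf N (K * r n)\<close> is at least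
    \<open>c / 2 * K powr m / n\<close>, so the factor \<open>n\<close> cancels.\<close>
  have "((\<lambda>K. exp (- (c / 2 * K powr m))) \<longlongrightarrow> 0) at_top"
    using c m by real_asymp
  then have "\<forall>\<^sub>F K in at_top. exp (- (c / 2 * K powr m)) < \<delta>"
    using delta by (rule order_tendstoD)
  then have "\<forall>\<^sub>F K in at_top. exp (- (c / 2 * K powr m)) < \<delta> \<and> K > 0"
    using eventually_gt_at_top by (rule eventually_conj)
  then obtain K where K: "exp (- (c / 2 * K powr m)) < \<delta>" "K > 0"
    using eventually_happens trivial_limit_at_top_linorder by blast
  \<comment> \<open>An upper bound, uniform in \<open>n\<close>, for the expected number of samples
    below \<open>2 * K * r n\<close>, since \<open>r n powr m = 1 / n\<close>.\<close>
  define N0 where "N0 = C0 * (2 * K) powr m"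
  have N0: "N0 > 0" using C0 K by (simp add: N0_def)
  obtain \<eta> r0 where \<eta>: "\<eta> > 0" "r0 > 0"
    "\<And>r s. \<lbrakk>0 < r; r < r0; s \<le> 2 * K * r\<rbrakk> \<Longrightarrow> P.prob {s - \<eta> * r..s + \<eta> * r} \<le> \<delta> / N0 * r powr m"
    using P.window_bound[of "2 * K" "\<delta> / N0"] K N0 delta by auto
  obtain t0 where t0: "t0 > 0" "\<And>t. \<lbrakk>0 \<le> t; t < t0\<rbrakk> \<Longrightarrow> \<bar>cdf N t - c * t powr m\<bar> \<le> c / 2 * t powr m"
    using P.cdf_approx[of "c / 2"] c by auto

  \<comment> \<open>The sum runs over all indices, including the minimiser, and thus does not refer
    to that random index; its expectation is a sum of \<open>n\<close> equal integrals against
    \<open>N\<close>.\<close>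
  define W where "W n \<omega> = (\<Sum>j\<in>{1..n}. exp (- (\<beta> n / 2 * T j \<omega>))
      + exp (- (\<beta> n * (\<eta> * r n))) * indicator {..2 * K * r n} (T j \<omega>))" for n \<omega>
  \<comment> \<open>Since \<open>n = r n powr (-m)\<close>, the factor \<open>n\<close> merges with
    \<open>(\<beta> n / 2) powr (-m)\<close>, and the bound depends on \<open>n\<close> only through
    the divergent product \<open>\<beta> n * r n\<close>.\<close>
  define w where "w n = C1 * ((\<beta> n * r n) / 2) powr (-m) + exp (- (\<eta> * (\<beta> n * r n))) * N0" for n
  have w_lim: "w \<longlonglongrightarrow> 0"
  proof -
    have "((\<lambda>x. C1 * (x / 2) powr (-m) + exp (- (\<eta> * x)) * N0) \<longlongrightarrow> 0) at_top"
      using m \<eta> N0 C1 by real_asymp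
    from filterlim_compose[OF this lim] show ?thesis
      unfolding w_def[abs_def] r_def by simp
  qed
  have W_int: "(\<integral>\<^sup>+\<omega>. ennreal (W n \<omega>) \<partial>M) \<le> ennreal (w n)" if n: "n \<ge> 1" for n
  proof -
    let ?g = "\<lambda>t. ennreal (exp (- (\<beta> n / 2 * t))) + ennreal (exp (- (\<beta> n * (\<eta> * r n)))) * indicator {..2 * K * r n} t"
    have "ennreal (W n \<omega>) = (\<Sum>j\<in>{1..n}. ?g (T j \<omega>))" for \<omega>
      unfolding W_def
      by (subst sum_ennreal[symmetric]) (auto simp: indicator_def intro!: sum.cong)
    then have "(\<integral>\<^sup>+\<omega>. ennreal (W n \<omega>) \<partial>M) = (\<Sum>j\<in>{1..n}. \<integral>\<^sup>+\<omega>. ?g (T j \<omega>) \<partial>M)"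
      using rv by (simp only:) (intro nn_integral_sum, measurable, auto)
    also have "\<dots> = (\<Sum>j\<in>{1..n}. \<integral>\<^sup>+t. ?g t \<partial>N)"
    proof (intro sum.cong refl)
      fix j assume "j \<in> {1..n}"
      then have "(\<integral>\<^sup>+\<omega>. ?g (T j \<omega>) \<partial>M) = (\<integral>\<^sup>+t. ?g t \<partial>distr M borel (T j))"
        using rv[of j] by (subst nn_integral_distr) auto
      then show "(\<integral>\<^sup>+\<omega>. ?g (T j \<omega>) \<partial>M) = (\<integral>\<^sup>+t. ?g t \<partial>N)"
        using law \<open>j \<in> {1..n}\<close> by simp
    qed
    also have "\<dots> = of_nat n * ((\<integral>\<^sup>+t. ennreal (exp (- (\<beta> n / 2 * t))) \<partial>N)
        + ennreal (exp (- (\<beta> n * (\<eta> * r n)))) * ennreal (cdf N (2 * K * r n)))"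
      by (subst nn_integral_add)
        (auto simp: P.emeasure_eq_measure cdf_def nn_integral_cmult_indicator)
    also have "\<dots> \<le> ennreal (real n) * (ennreal (C1 * (\<beta> n / 2) powr (- m))
        + ennreal (exp (- (\<beta> n * (\<eta> * r n)))) * ennreal (C0 * (2 * K * r n) powr m))"
      unfolding ennreal_of_nat_eq_real_of_nat
      using beta[OF n] r_pos[OF n] K
      by (intro mult_left_mono add_mono C1 ennreal_leI C0) auto
    also have "\<dots> = ennreal (real n * (C1 * (\<beta> n / 2) powr (- m)
        + exp (- (\<beta> n * (\<eta> * r n))) * (C0 * (2 * K * r n) powr m)))"
      using C1 C0 by (simp add: ennreal_mult ennreal_plus)
    also have "real n * (C1 * (\<beta> n / 2) powr (- m)
        + exp (- (\<beta> n * (\<eta> * r n))) * (C0 * (2 * K * r n) powr m)) = w n"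
    proof -
      have "(2 * K * r n) powr m = (2 * K) powr m / real n"
        using K r_pos[OF n] r_m[OF n] powr_mult[of "2 * K" "r n" m] by simp
      moreover have "(\<beta> n * r n / 2) powr (- m) = (\<beta> n / 2) powr (- m) * r n powr (- m)"
        using beta[OF n] r_pos[OF n] powr_mult[of "\<beta> n / 2" "r n" "- m"] by simp
      moreover have "r n powr (- m) = real n"
        using r_m[OF n] by (simp add: powr_minus)
      ultimately show ?thesis
        using n by (simp add: w_def N0_def field_simps)
    qed
    finally show ?thesis .
  qed

  have "r \<longlonglongrightarrow> 0"
    using r_lim by (simp add: filterlim_at)
  then have "\<forall>\<^sub>F n in sequentially. r n < min r0 (t0 / K)"
    using \<eta> t0 K by (intro order_tendstoD) auto
  moreover have "\<forall>\<^sub>F n in sequentially. w n < \<epsilon> * \<delta>"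
    using w_lim eps delta by (intro order_tendstoD) auto
  ultimately show ?thesis
    using eventually_ge_at_top[of 1]
  proof eventually_elim
    case (elim n)
    then have n: "n \<ge> 1" and rn: "0 < r n" "r n < r0" "K * r n < t0"
      using r_pos K by (auto simp: field_simps)
    have [measurable]: "random_variable borel (T i)" if "i \<in> {1..n}" for i
      using rv that by auto
    define B1 where "B1 = {\<omega> \<in> space M. \<forall>i\<in>{1..n}. T i \<omega> > K * r n}"
    \<comment> \<open>Asymmetric on purpose: \<open>j\<close> will be the competitor known to lie
      below \<open>2 * K * r n\<close>, and \<open>k\<close> the minimiser.\<close>
    define E where "E j k = {\<omega> \<in> space M. T j \<omega> \<le> 2 * K * r n \<and> \<bar>T k \<omega> - T j \<omega>\<bar> \<le> \<eta> * r n}" for j k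
    define B2 where "B2 = (\<Union>(j, k)\<in>{1..n} \<times> {1..n} - Id. E j k)"
    define B3 where "B3 = {\<omega> \<in> space M. W n \<omega> \<ge> \<epsilon>}"
    have B1: "B1 \<in> events" unfolding B1_def by measurable
    have E: "E j k \<in> events" if "j \<in> {1..n}" "k \<in> {1..n}" for j k
      unfolding E_def using that by measurable
    have B2: "B2 \<in> events"
      unfolding B2_def using E by (intro sets.finite_UN) auto
    have W_meas: "W n \<in> borel_measurable M"
      unfolding W_def by measurable
    have B3: "B3 \<in> events" unfolding B3_def using W_meas by measurable

    have "prob B1 \<le> exp (- (real n * cdf N (K * r n)))"
      unfolding B1_def by (rule prob_all_greater_le[OF indep law])
    also have "\<dots> \<le> exp (- (c / 2 * K powr m))"
    proof -
      have "c / 2 * (K * r n) powr m \<le> cdf N (K * r n)"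
        using abs_le_D2[OF t0(2)[of "K * r n"]] K rn by simp
      then have "real n * (c / 2 * (K * r n) powr m) \<le> real n * cdf N (K * r n)"
        by (intro mult_left_mono) auto
      moreover have "real n * (c / 2 * (K * r n) powr m) = c / 2 * K powr m"
        using r_m[OF n] K rn n by (simp add: powr_mult)
      ultimately show ?thesis by (simp only: exp_le_cancel_iff neg_le_iff_le)
    qed
    finally have pB1: "prob B1 \<le> \<delta>" using K by simp

    have "prob B2 \<le> (\<Sum>(j, k)\<in>{1..n} \<times> {1..n} - Id. prob (E j k))"
      unfolding B2_def using E
      by (intro order.trans[OF finite_measure_subadditive_finite]) (auto simp: case_prod_unfold)
    also have "\<dots> \<le> (\<Sum>(j, k)\<in>{1..n} \<times> {1..n} - Id. \<delta> / real n ^ 2)"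
    proof (intro sum_mono)
      fix z assume "z \<in> {1..n} \<times> {1..n} - Id"
      then obtain j k where z: "z = (j, k)" and jk: "j \<in> {1..n}" "k \<in> {1..n}" "j \<noteq> k"
        by (cases z) auto
      have "indep_var borel (T j) borel (T k)"
        using jk by (intro indep_vars_imp_indep_var[OF indep]) auto
      then have "prob (E j k) \<le> cdf N (2 * K * r n) * (\<delta> / N0 * r n powr m)"
        unfolding E_def using jk delta N0 rn
        by (intro prob_near_tie_le law \<eta>) auto
      also have "\<dots> \<le> (C0 * (2 * K * r n) powr m) * (\<delta> / N0 * r n powr m)"
        using C0 K rn delta N0 by (intro mult_right_mono C0) auto
      also have "\<dots> = \<delta> / real n ^ 2"
        using r_m[OF n] K rn C0(1) n powr_mult[of "2 * K" "r n" m]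
        by (simp add: power2_eq_square N0_def field_simps)
      finally show "(case z of (j, k) \<Rightarrow> prob (E j k)) \<le> (case z of (j, k) \<Rightarrow> \<delta> / real n ^ 2)"
        by (simp add: z)
    qed
    also have "\<dots> = real (card ({1..n} \<times> {1..n} - Id)) * (\<delta> / real n ^ 2)"
      by simp
    also have "\<dots> \<le> real (n * n) * (\<delta> / real n ^ 2)"
    proof (intro mult_right_mono of_nat_mono)
      show "card ({1..n} \<times> {1..n} - Id) \<le> n * n"
        using card_mono[of "{1..n} \<times> {1..n}" "{1..n} \<times> {1..n} - Id"] by (simp add: card_cartesian_product)
    qed (use delta in auto)
    also have "\<dots> = \<delta>" using n by (simp add: power2_eq_square)
    finally have pB2: "prob B2 \<le> \<delta>" .

    \<comment> \<open>Markov's inequality at level \<open>\<epsilon>\<close> costs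
      \<open>w n / \<epsilon>\<close>, which is below \<open>\<delta>\<close> by the choice of
      \<open>n\<close>.\<close>
    have "B3 = {\<omega> \<in> space M. 1 \<le> ennreal (1 / \<epsilon>) * ennreal (W n \<omega>)}"
    proof -
      have "1 \<le> ennreal (1 / \<epsilon>) * ennreal (W n \<omega>) \<longleftrightarrow> \<epsilon> \<le> W n \<omega>" for \<omega>
      proof -
        have "ennreal (1 / \<epsilon>) * ennreal (W n \<omega>) = ennreal (W n \<omega> / \<epsilon>)"
          using eps by (simp flip: ennreal_mult')
        then show ?thesis
          using ennreal_le_iff2[of 1 "W n \<omega> / \<epsilon>"] eps by (auto simp: field_simps)
      qed
      then show ?thesis by (simp add: B3_def)
    qed
    also have "emeasure M \<dots> \<le> ennreal (1 / \<epsilon>) * (\<integral>\<^sup>+\<omega>. ennreal (W n \<omega>) * indicator (space M) \<omega> \<partial>M)"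
      using W_meas by (intro nn_integral_Markov_inequality) auto
    also have "(\<integral>\<^sup>+\<omega>. ennreal (W n \<omega>) * indicator (space M) \<omega> \<partial>M) = (\<integral>\<^sup>+\<omega>. ennreal (W n \<omega>) \<partial>M)"
      by (intro nn_integral_cong) auto
    also have "ennreal (1 / \<epsilon>) * \<dots> \<le> ennreal (1 / \<epsilon>) * ennreal (w n)"
      by (intro mult_left_mono W_int n) auto
    also have "\<dots> \<le> ennreal (1 / \<epsilon>) * ennreal (\<epsilon> * \<delta>)"
      using elim by (intro mult_left_mono ennreal_leI) auto
    also have "\<dots> = ennreal \<delta>"
      using eps delta by (simp flip: ennreal_mult)
    finally have pB3: "prob B3 \<le> \<delta>"
      using delta by (simp add: emeasure_eq_measure)

    have "prob (B1 \<union> B2 \<union> B3) \<le> 3 * \<delta>"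
      using measure_Un_le[of "B1 \<union> B2" M B3] measure_Un_le[of B1 M B2]
        B1 B2 B3 pB1 pB2 pB3 by simp
    moreover have "\<exists>k\<in>{1..n}. (\<Sum>j\<in>{1..n}-{k}. exp (- (\<beta> n * (T j \<omega> - T k \<omega>)))) < \<epsilon>"
      if \<omega>: "\<omega> \<in> space M - (B1 \<union> B2 \<union> B3)" for \<omega>
    proof -
      obtain k where k: "k \<in> {1..n}" "\<And>j. j \<in> {1..n} \<Longrightarrow> T k \<omega> \<le> T j \<omega>"
        using ex_is_arg_min_if_finite[of "{1..n}" "\<lambda>j. T j \<omega>"] n by (force simp: is_arg_min_linorder)
      obtain i where "i \<in> {1..n}" "T i \<omega> \<le> K * r n"
        using \<omega> by (force simp: B1_def)
      with k have Tk: "T k \<omega> \<le> K * r n" by force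
      have bn: "\<beta> n > 0" using beta n by auto
      let ?t = "\<lambda>j. exp (- (\<beta> n / 2 * T j \<omega>)) + exp (- (\<beta> n * (\<eta> * r n))) * indicator {..2 * K * r n} (T j \<omega>)"
      have "exp (- (\<beta> n * (T j \<omega> - T k \<omega>))) \<le> ?t j" if j: "j \<in> {1..n} - {k}" for j
      proof (cases "T j \<omega> \<le> 2 * K * r n")
        case True
        \<comment> \<open>Outside \<open>B2\<close> the pair is not a near tie, and minimality of
          \<open>T k \<omega>\<close> fixes the sign of the gap.\<close>
        have "\<omega> \<notin> E j k" using \<omega> j k(1) by (auto simp: B2_def)
        then have "\<eta> * r n \<le> T j \<omega> - T k \<omega>"
          using True \<omega> k(2)[of j] j by (auto simp: E_def)
        then have "exp (- (\<beta> n * (T j \<omega> - T k \<omega>))) \<le> exp (- (\<beta> n * (\<eta> * r n)))"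
          using bn by simp
        then show ?thesis using True by (simp add: add_increasing)
      next
        case False
        then have "T j \<omega> / 2 \<le> T j \<omega> - T k \<omega>" using Tk by simp
        then have "exp (- (\<beta> n * (T j \<omega> - T k \<omega>))) \<le> exp (- (\<beta> n * (T j \<omega> / 2)))"
          using bn by simp
        then show ?thesis using False by simp
      qed
      then have "(\<Sum>j\<in>{1..n}-{k}. exp (- (\<beta> n * (T j \<omega> - T k \<omega>)))) \<le> (\<Sum>j\<in>{1..n}-{k}. ?t j)"
        by (rule sum_mono)
      also have "\<dots> \<le> W n \<omega>"
        unfolding W_def by (intro sum_mono2) auto
      also have "\<dots> < \<epsilon>" using \<omega> by (auto simp: B3_def)
      finally show ?thesis using k(1) by blast
    qed
    ultimately show ?case using B1 B2 B3 by (intro bexI[of _ "B1 \<union> B2 \<union> B3"]) auto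
  qed
qed

section \<open>Orthogonal invariance of Lebesgue measure\<close>

text \<open>The case \<open>c = 1\<close> supplies the shears used below; \<open>c = -1\<close>
  evaluates integrals of \<open>a (t - y)\<close> over \<open>y\<close>.\<close>

lemma nn_integral_lborel_shift_reflect:
  fixes t :: "'a::euclidean_space"
  assumes [measurable]: "g \<in> borel_measurable borel" and c: "\<bar>c\<bar> = 1"
  shows "(\<integral>\<^sup>+x. g (t + c *\<^sub>R x) \<partial>lborel) = (\<integral>\<^sup>+x. g x \<partial>lborel)"
proof -
  have [measurable]: "(\<lambda>x. t + c *\<^sub>R x) \<in> borel_measurable borel" by measurable
  have "(\<integral>\<^sup>+x. g x \<partial>lborel) = (\<integral>\<^sup>+x. g x \<partial>density (distr lborel borel (\<lambda>x. t + c *\<^sub>R x)) (\<lambda>_. ennreal (\<bar>c\<bar> ^ DIM('a))))"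
    using c by (subst lborel_affine[of c t]) auto
  also have "\<dots> = (\<integral>\<^sup>+x. g (t + c *\<^sub>R x) \<partial>lborel)"
    by (simp add: c density_1 nn_integral_distr)
  finally show ?thesis ..
qed

text \<open>Uniqueness of Haar measure up to a factor, specialised to the image measure under \<open>f\<close>: integrate
  \<open>indicator A (f x) * indicator (ball 0 1) y\<close> over both variables and exchange their roles by two shears.
  The factor is one because \<open>f\<close> preserves the unit ball.\<close>
lemma emeasure_lborel_orthogonal_vimage:
  fixes f :: "'a::euclidean_space \<Rightarrow> 'a"
  assumes f: "orthogonal_transformation f" and A [measurable]: "A \<in> sets borel"
  shows "emeasure lborel (f -` A) = emeasure lborel A"
proof -
  have lin: "linear f" using f by (rule orthogonal_transformation_linear)
  have [measurable]: "f \<in> borel_measurable borel"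
    using lin by (intro borel_measurable_continuous_onI linear_continuous_on linear_conv_bounded_linear[THEN iffD1])
  define a b :: "'a \<Rightarrow> ennreal" where "a = indicator A" and "b = indicator (ball 0 1)"
  have [measurable]: "a \<in> borel_measurable borel" "b \<in> borel_measurable borel"
    unfolding a_def b_def by (intro borel_measurable_indicator; simp)+
  have vim: "(\<integral>\<^sup>+x. indicator B (f x) \<partial>lborel) = emeasure lborel (f -` B)" if [measurable]: "B \<in> sets borel" for B
  proof -
    have "f -` B \<in> sets lborel"
      using measurable_sets[OF \<open>f \<in> borel_measurable borel\<close> that] by simp
    then have "emeasure lborel (f -` B) = (\<integral>\<^sup>+x. indicator (f -` B) x \<partial>lborel)"
      by simp
    then show ?thesis by (simp add: indicator_vimage comp_def)
  qed
  have "emeasure lborel (f -` A) * emeasure lborel (ball (0::'a) 1) = (\<integral>\<^sup>+x. a (f x) * (\<integral>\<^sup>+y. b y \<partial>lborel) \<partial>lborel)"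
    by (simp add: nn_integral_multc vim a_def b_def)
  also have "\<dots> = (\<integral>\<^sup>+x. a (f x) * (\<integral>\<^sup>+y. b (f x + y) \<partial>lborel) \<partial>lborel)"
  proof -
    have "(\<integral>\<^sup>+y. b (t + y) \<partial>lborel) = (\<integral>\<^sup>+y. b y \<partial>lborel)" for t
      using nn_integral_lborel_shift_reflect[of b 1 t] by simp
    then show ?thesis by (simp only:)
  qed
  also have "\<dots> = (\<integral>\<^sup>+x. \<integral>\<^sup>+y. a (f x) * b (f x + y) \<partial>lborel \<partial>lborel)"
    by (intro nn_integral_cong nn_integral_cmult[symmetric]) measurable
  also have "\<dots> = (\<integral>\<^sup>+y. \<integral>\<^sup>+x. a (f x) * b (f x + y) \<partial>lborel \<partial>lborel)"
    by (rule lborel_pair.Fubini'[symmetric]) measurable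
  also have "\<dots> = (\<integral>\<^sup>+y. \<integral>\<^sup>+x. a (f x - y) * b (f x) \<partial>lborel \<partial>lborel)"
  proof (rule nn_integral_cong)
    fix y
    \<comment> \<open>Translating \<open>x\<close> by a preimage of \<open>y\<close> turns
      \<open>f x\<close> into \<open>f x + y\<close>; linearity and surjectivity of \<open>f\<close>
      enter here.\<close>
    obtain z where z: "f z = y"
      using orthogonal_transformation_surj[OF f] by (metis surjD)
    show "(\<integral>\<^sup>+x. a (f x) * b (f x + y) \<partial>lborel) = (\<integral>\<^sup>+x. a (f x - y) * b (f x) \<partial>lborel)"
      using nn_integral_lborel_shift_reflect[of "\<lambda>x. a (f x - y) * b (f x)" 1 z]
      by (simp add: linear_add[OF lin] z add.commute)
  qed
  also have "\<dots> = (\<integral>\<^sup>+x. \<integral>\<^sup>+y. a (f x - y) * b (f x) \<partial>lborel \<partial>lborel)"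
    by (rule lborel_pair.Fubini') measurable
  also have "\<dots> = (\<integral>\<^sup>+x. (\<integral>\<^sup>+y. a (f x - y) \<partial>lborel) * b (f x) \<partial>lborel)"
    by (intro nn_integral_cong nn_integral_multc) measurable
  also have "\<dots> = (\<integral>\<^sup>+x. emeasure lborel A * b (f x) \<partial>lborel)"
  proof -
    have "(\<integral>\<^sup>+y. a (t - y) \<partial>lborel) = emeasure lborel A" for t
      using nn_integral_lborel_shift_reflect[of a "-1" t] by (simp add: a_def)
    then show ?thesis by (simp only:)
  qed
  also have "\<dots> = emeasure lborel A * emeasure lborel (f -` ball 0 1)"
    by (subst nn_integral_cmult, measurable) (simp add: vim b_def)
  also have "f -` ball 0 1 = ball 0 1"
    by (auto simp: orthogonal_transformation_norm[OF f])
  finally have "emeasure lborel (f -` A) * emeasure lborel (ball (0::'a) 1) = emeasure lborel A * emeasure lborel (ball (0::'a) 1)" .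
  moreover have "emeasure lborel (ball (0::'a) 1) \<noteq> \<infinity>"
    using emeasure_lborel_ball_finite[of "0::'a" 1] by simp
  moreover have "emeasure lborel (ball (0::'a) 1) \<noteq> 0"
    using content_ball_pos[of 1 "0::'a"] by (auto simp: measure_def)
  ultimately show ?thesis
    by (simp add: ennreal_mult_cancel_left mult.commute[of _ "emeasure lborel (ball 0 1)"])
qed

section \<open>Volumes of solid cones and spherical caps\<close>

text \<open>For unit \<open>q\<close> and \<open>\<tau> \<ge> 0\<close> the last inequality bounds
  the component of \<open>y\<close> orthogonal to \<open>q\<close> by
  \<open>\<tau> * (q \<bullet> y)\<close>, so \<open>\<tau>\<close> is the tangent of the
  half-opening angle. Using only norm and inner product makes rotation covariance immediate.\<close>

definition solid_cone :: "'a::euclidean_space \<Rightarrow> real \<Rightarrow> real \<Rightarrow> 'a set" where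
  "solid_cone q h \<tau> = {y. 0 < q \<bullet> y \<and> q \<bullet> y \<le> h \<and> (norm y)\<^sup>2 \<le> (1 + \<tau>\<^sup>2) * (q \<bullet> y)\<^sup>2}"

lemma sets_solid_cone [measurable]: "solid_cone q h \<tau> \<in> sets borel"
  unfolding solid_cone_def by measurable

lemma bounded_solid_cone: "bounded (solid_cone q h \<tau>)"
proof -
  have "norm y \<le> sqrt ((1 + \<tau>\<^sup>2) * h\<^sup>2)" if "y \<in> solid_cone q h \<tau>" for y
  proof -
    have "(norm y)\<^sup>2 \<le> (1 + \<tau>\<^sup>2) * (q \<bullet> y)\<^sup>2" and "0 < q \<bullet> y" "q \<bullet> y \<le> h"
      using that by (auto simp: solid_cone_def)
    moreover have "(1 + \<tau>\<^sup>2) * (q \<bullet> y)\<^sup>2 \<le> (1 + \<tau>\<^sup>2) * h\<^sup>2"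
      using calculation by (intro mult_left_mono power_mono) auto
    ultimately show ?thesis by (intro real_le_rsqrt) auto
  qed
  then show ?thesis by (auto simp: bounded_iff)
qed

lemma lmeasurable_solid_cone: "solid_cone q h \<tau> \<in> lmeasurable"
  by (intro bounded_set_imp_lmeasurable bounded_solid_cone) auto

text \<open>With a coordinate vector as axis the dilation is diagonal, and its determinant gives the
  powers of \<open>h\<close> and \<open>\<tau>\<close>. The reference volume stays unevaluated, as
  it affects only the limit constant.\<close>

lemma measure_solid_cone_axis:
  fixes k :: "'d::finite"
  assumes "h > 0" "\<tau> > 0"
  shows "measure lebesgue (solid_cone (axis k 1 :: real ^ 'd) h \<tau>)
       = h ^ CARD('d) * \<tau> ^ (CARD('d) - 1) * measure lebesgue (solid_cone (axis k 1 :: real ^ 'd) 1 1)"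
proof -
  \<comment> \<open>The base at height \<open>h\<close> has radius \<open>h * \<tau>\<close>,
    whereas height and radius of the reference cone are both \<open>1\<close>.\<close>
  define s where "s i = (if i = k then h else h * \<tau>)" for i
  have s_pos: "s i > 0" for i using assms by (simp add: s_def)
  have mem: "y \<in> solid_cone (axis k 1) h' \<tau>' \<longleftrightarrow>
      0 < y $ k \<and> y $ k \<le> h' \<and> (\<Sum>i\<in>UNIV - {k}. (y $ i)\<^sup>2) \<le> \<tau>'\<^sup>2 * (y $ k)\<^sup>2"
    for y :: "real ^ 'd" and h' \<tau>'
  proof -
    have "(norm y)\<^sup>2 = (y $ k)\<^sup>2 + (\<Sum>i\<in>UNIV - {k}. (y $ i)\<^sup>2)"
      unfolding power2_norm_eq_inner inner_vec_def
      by (subst sum.remove[of _ k]) (auto simp: power2_eq_square)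
    then show ?thesis
      by (auto simp: solid_cone_def inner_axis' algebra_simps)
  qed
  have stretch: "(\<chi> i. s i * y $ i) \<in> solid_cone (axis k 1) h \<tau> \<longleftrightarrow> y \<in> solid_cone (axis k 1) 1 1" for y :: "real ^ 'd"
  proof -
    have "(\<Sum>i\<in>UNIV - {k}. (s i * y $ i)\<^sup>2) = (h * \<tau>)\<^sup>2 * (\<Sum>i\<in>UNIV - {k}. (y $ i)\<^sup>2)"
      by (simp add: s_def sum_distrib_left power_mult_distrib)
    moreover have "\<tau>\<^sup>2 * (s k * y $ k)\<^sup>2 = (h * \<tau>)\<^sup>2 * (y $ k)\<^sup>2"
      by (simp add: s_def power_mult_distrib)
    ultimately show ?thesis
      using assms by (simp add: mem zero_less_mult_iff s_def)
  qed
  have "solid_cone (axis k 1 :: real ^ 'd) h \<tau> = (\<lambda>y. \<chi> i. s i * y $ i) ` solid_cone (axis k 1) 1 1"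
  proof (intro equalityI subsetI)
    fix y :: "real ^ 'd" assume y: "y \<in> solid_cone (axis k 1) h \<tau>"
    have eq: "y = (\<chi> i. s i * (\<chi> i. y $ i / s i) $ i)"
      using s_pos by (simp add: vec_eq_iff less_imp_neq[symmetric])
    moreover have "(\<chi> i. y $ i / s i) \<in> solid_cone (axis k 1) 1 1"
      using y by (subst stretch[symmetric], subst eq[symmetric])
    ultimately show "y \<in> (\<lambda>y. \<chi> i. s i * y $ i) ` solid_cone (axis k 1) 1 1"
      by (rule image_eqI)
  qed (auto simp: stretch)
  then have "measure lebesgue (solid_cone (axis k 1 :: real ^ 'd) h \<tau>)
      = \<bar>prod s UNIV\<bar> * measure lebesgue (solid_cone (axis k 1 :: real ^ 'd) 1 1)"
    by (simp only: measure_stretch[OF lmeasurable_solid_cone])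
  also have "prod s UNIV = h * (h * \<tau>) ^ (CARD('d) - 1)"
    by (subst prod.remove[of _ k]) (auto simp: s_def card_Diff_singleton)
  also have "\<dots> = h ^ CARD('d) * \<tau> ^ (CARD('d) - 1)"
    by (simp add: power_mult_distrib flip: power_Suc)
  finally show ?thesis using assms by simp
qed

text \<open>A rotation taking \<open>q\<close> to a coordinate axis pulls the axis cone back to the
  cone around \<open>q\<close> and preserves volume.\<close>

lemma measure_solid_cone:
  fixes q :: "real ^ 'd"
  assumes "norm q = 1" "h > 0" "\<tau> > 0"
  shows "measure lborel (solid_cone q h \<tau>)
       = h ^ CARD('d) * \<tau> ^ (CARD('d) - 1) * measure lborel (solid_cone q 1 1)"
proof -
  fix k :: 'd
  obtain f :: "real ^ 'd \<Rightarrow> real ^ 'd" where f: "orthogonal_transformation f" "f q = axis k 1"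
    by (rule orthogonal_transformation_exists_1[of q "axis k 1"]) (simp_all add: assms(1))
  have inner: "f x \<bullet> f y = x \<bullet> y" for x y
    using f(1) by (simp add: orthogonal_transformation_def)
  have nrm: "norm (f x) = norm x" for x
    using f(1) by (rule orthogonal_transformation_norm)
  have "f -` solid_cone (axis k 1) a b = solid_cone q a b" for a b
    by (simp add: solid_cone_def f(2)[symmetric] inner nrm vimage_def)
  then have "measure lborel (solid_cone q a b) = measure lborel (solid_cone (axis k 1 :: real ^ 'd) a b)" for a b
    using emeasure_lborel_orthogonal_vimage[OF f(1) sets_solid_cone[of "axis k 1" a b]]
    by (simp add: measure_def)
  then show ?thesis using measure_solid_cone_axis[OF assms(2,3), of k] by simp
qed

lemma measure_solid_cone_pos:
  fixes q :: "'a::euclidean_space"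
  assumes "norm q = 1"
  shows "measure lborel (solid_cone q 1 1) > 0"
proof -
  define U where "U = {y. 0 < q \<bullet> y} \<inter> {y. q \<bullet> y < 1} \<inter> {y. (norm y)\<^sup>2 < 2 * (q \<bullet> y)\<^sup>2}"
  have "open U"
    unfolding U_def by (intro open_Int open_Collect_less continuous_intros)
  \<comment> \<open>A point on the axis at half height satisfies all three strict
    inequalities.\<close>
  moreover have "(1 / 2) *\<^sub>R q \<in> U"
    using assms by (auto simp: U_def power2_eq_square dot_square_norm)
  ultimately have "\<not> negligible U"
    using open_not_negligible by blast
  moreover have "U \<subseteq> solid_cone q 1 1"
    by (auto simp: U_def solid_cone_def)
  ultimately have "\<not> negligible (solid_cone q 1 1)"
    using negligible_subset by blast
  then have "measure lebesgue (solid_cone q 1 1) \<noteq> 0"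
    using lmeasurable_solid_cone negligible_iff_measure by blast
  then show ?thesis
    by (simp add: zero_less_measure_iff)
qed

section \<open>Surface measure of spherical caps\<close>

lemma sets_sphere_measure [simp, measurable_cong]: "sets sphere_measure = sets borel"
  by (simp add: sphere_measure_def)

lemma emeasure_sphere_measure:
  fixes A :: "'a::euclidean_space set"
  assumes [measurable]: "A \<in> sets borel"
  shows "emeasure sphere_measure A = of_nat DIM('a) * emeasure lborel {y \<in> cball 0 1. y /\<^sub>R norm y \<in> A}"
proof -
  have [measurable]: "(\<lambda>y::'a. y /\<^sub>R norm y) \<in> borel_measurable borel" by measurable
  have sets: "(\<lambda>y. y /\<^sub>R norm y) -` A \<in> sets borel"
    using measurable_sets[OF \<open>(\<lambda>y::'a. y /\<^sub>R norm y) \<in> borel_measurable borel\<close> assms] by simp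
  have "emeasure sphere_measure A =
      (\<integral>\<^sup>+y. of_nat DIM('a) * indicator (cball 0 1) y * indicator ((\<lambda>y. y /\<^sub>R norm y) -` A) y \<partial>lborel)"
    unfolding sphere_measure_def using sets
    by (simp add: emeasure_distr emeasure_density borel_measurable_times_ennreal borel_measurable_indicator)
  also have "\<dots> = (\<integral>\<^sup>+y. of_nat DIM('a) * indicator {y \<in> cball 0 1. y /\<^sub>R norm y \<in> A} y \<partial>lborel)"
    by (intro nn_integral_cong) (auto simp: indicator_def)
  also have "\<dots> = of_nat DIM('a) * emeasure lborel {y \<in> cball 0 1. y /\<^sub>R norm y \<in> A}"
    by (intro nn_integral_cmult_indicator) measurable
  finally show ?thesis .
qed

lemma finite_sphere_measure: "finite_measure (sphere_measure :: 'a::euclidean_space measure)"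
proof
  have "emeasure sphere_measure (space (sphere_measure :: 'a measure)) = of_nat DIM('a) * emeasure lborel (cball 0 1 :: 'a set)"
  proof -
    have "{y \<in> cball (0::'a) 1. y /\<^sub>R norm y \<in> UNIV} = cball 0 1" by auto
    then show ?thesis
      using emeasure_sphere_measure[of "UNIV :: 'a set"]
      by (simp only: sphere_measure_def space_distr space_borel sets.top) simp
  qed
  also have "\<dots> < \<infinity>"
    using emeasure_lborel_cball_finite[of "0::'a" 1] by (simp add: ennreal_mult_less_top of_nat_less_top)
  finally show "emeasure sphere_measure (space (sphere_measure :: 'a measure)) \<noteq> \<infinity>" by simp
qed

text \<open>Radial projection misses the sphere only at the origin, which division by zero sends to
  \<open>0\<close>; a single point has volume zero.\<close>

lemma AE_sphere_measure: "AE x in sphere_measure. x \<in> sphere (0 :: 'a::euclidean_space) 1"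
proof -
  have "{y \<in> cball (0::'a) 1. y /\<^sub>R norm y \<in> - sphere 0 1} \<subseteq> {0}"
  proof
    fix y assume "y \<in> {y \<in> cball (0::'a) 1. y /\<^sub>R norm y \<in> - sphere 0 1}"
    then have "norm (y /\<^sub>R norm y) \<noteq> 1" by auto
    then show "y \<in> {0}" by (cases "y = 0") auto
  qed
  then have "emeasure lborel {y \<in> cball (0::'a) 1. y /\<^sub>R norm y \<in> - sphere 0 1} \<le> emeasure lborel {0::'a}"
    by (intro emeasure_mono) auto
  then have "emeasure sphere_measure (- sphere (0::'a) 1) = 0"
    by (subst emeasure_sphere_measure) auto
  then show ?thesis
    by (intro AE_I[of _ _ "- sphere 0 1"]) auto
qed

text \<open>Here \<open>\<tau>\<close> is the tangent of the angular radius of the cap, whose cosine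
  is \<open>1 - t\<close>. The ball sector over the cap lies in the cone of height \<open>1\<close>,
  because \<open>q \<bullet> y \<le> norm y \<le> 1\<close>, and contains the cone of height
  \<open>1 - t\<close>, where \<open>(1 - t) * norm y \<le> q \<bullet> y \<le> 1 - t\<close> forces
  \<open>norm y \<le> 1\<close>.\<close>

lemma measure_cap_bounds:
  fixes q :: "real ^ 'd" and V \<tau> t :: real
  assumes q: "norm q = 1" and t: "0 < t" "t < 1"
  defines "V \<equiv> measure lborel (solid_cone q 1 1)" and "\<tau> \<equiv> sqrt (1 / (1 - t)\<^sup>2 - 1)"
  shows "measure sphere_measure {x. 1 - q \<bullet> x \<le> t} \<le> CARD('d) * \<tau> ^ (CARD('d) - 1) * V"
    and "CARD('d) * (1 - t) ^ CARD('d) * \<tau> ^ (CARD('d) - 1) * V \<le> measure sphere_measure {x. 1 - q \<bullet> x \<le> t}"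
proof -
  have "(1 - t)\<^sup>2 < 1" using t by (simp add: power_less_one_iff abs_square_less_1)
  then have "1 / (1 - t)\<^sup>2 > 1" using t by (simp add: field_simps)
  then have tau: "\<tau> > 0" "1 + \<tau>\<^sup>2 = 1 / (1 - t)\<^sup>2" by (auto simp: \<tau>_def)
  define A where "A = {y. y \<in> cball 0 1 \<and> y /\<^sub>R norm y \<in> {x. 1 - q \<bullet> x \<le> t}}"
  have A: "A \<in> sets borel" unfolding A_def by measurable
  \<comment> \<open>The origin lies on neither side: it is normalised to \<open>0\<close>, which
    would belong to the cap only if \<open>1 \<le> t\<close>.\<close>
  have A_iff: "y \<in> A \<longleftrightarrow> norm y \<le> 1 \<and> 0 < q \<bullet> y \<and> (1 - t) * norm y \<le> q \<bullet> y" for y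
  proof (cases "y = 0")
    case False
    then have "1 - q \<bullet> (y /\<^sub>R norm y) \<le> t \<longleftrightarrow> (1 - t) * norm y \<le> q \<bullet> y"
      by (simp add: field_simps)
    moreover have "(1 - t) * norm y > 0" using False t by simp
    ultimately show ?thesis by (auto simp: A_def)
  qed (use t in \<open>auto simp: A_def\<close>)
  have cone_iff: "(norm y)\<^sup>2 \<le> (1 + \<tau>\<^sup>2) * (q \<bullet> y)\<^sup>2 \<longleftrightarrow> (1 - t) * norm y \<le> q \<bullet> y" if "q \<bullet> y > 0" for y
  proof -
    have "(norm y)\<^sup>2 \<le> (1 + \<tau>\<^sup>2) * (q \<bullet> y)\<^sup>2 \<longleftrightarrow> ((1 - t) * norm y)\<^sup>2 \<le> (q \<bullet> y)\<^sup>2"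
      using t by (simp add: tau power_mult_distrib pos_le_divide_eq mult.commute)
    also have "\<dots> \<longleftrightarrow> (1 - t) * norm y \<le> q \<bullet> y"
      using that t by (simp add: abs_le_square_iff[symmetric])
    finally show ?thesis .
  qed
  have sup: "A \<subseteq> solid_cone q 1 \<tau>"
    using Cauchy_Schwarz_ineq2[of q] q
    by (auto simp: A_iff solid_cone_def cone_iff) (meson abs_le_D1 order_trans)
  have sub: "solid_cone q (1 - t) \<tau> \<subseteq> A"
  proof
    fix y assume y: "y \<in> solid_cone q (1 - t) \<tau>"
    then have *: "0 < q \<bullet> y" "q \<bullet> y \<le> 1 - t" "(1 - t) * norm y \<le> q \<bullet> y"
      by (auto simp: solid_cone_def cone_iff)
    then have le: "(1 - t) * norm y \<le> (1 - t) * 1"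
      using order_trans[OF *(3) *(2)] by simp
    have "norm y \<le> 1" using mult_left_le_imp_le[OF le] t by linarith
    with * show "y \<in> A" by (simp add: A_iff)
  qed
  have cone_fm: "solid_cone q h \<tau>' \<in> fmeasurable lborel" for h \<tau>'
    using emeasure_bounded_finite[OF bounded_solid_cone[of q h \<tau>']] by (intro fmeasurableI) auto
  have "A \<in> sets lborel" using A by simp
  then have A_fm: "A \<in> fmeasurable lborel"
    by (rule fmeasurableI2[OF cone_fm sup])
  have "measure lborel A \<le> measure lborel (solid_cone q 1 \<tau>)"
    using sup A_fm cone_fm by (intro measure_mono_fmeasurable fmeasurableD)
  moreover have "measure lborel (solid_cone q (1 - t) \<tau>) \<le> measure lborel A"
    using sub A_fm cone_fm by (intro measure_mono_fmeasurable fmeasurableD)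
  moreover have "emeasure sphere_measure {x. 1 - q \<bullet> x \<le> t} = of_nat CARD('d) * emeasure lborel A"
    by (subst emeasure_sphere_measure) (simp_all add: A_def)
  then have "measure sphere_measure {x. 1 - q \<bullet> x \<le> t} = CARD('d) * measure lborel A"
    by (simp add: measure_def enn2real_mult)
  ultimately show "measure sphere_measure {x. 1 - q \<bullet> x \<le> t} \<le> CARD('d) * \<tau> ^ (CARD('d) - 1) * V"
    and "CARD('d) * (1 - t) ^ CARD('d) * \<tau> ^ (CARD('d) - 1) * V \<le> measure sphere_measure {x. 1 - q \<bullet> x \<le> t}"
    using measure_solid_cone[OF q _ tau(1), of 1] measure_solid_cone[OF q _ tau(1), of "1 - t"] t
    by (simp_all add: V_def mult.assoc)
qed

text \<open>The two cap bounds differ by the factor \<open>(1 - t) ^ d\<close>, which tends to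
  \<open>1\<close>. As \<open>\<tau>\<close> squared behaves like \<open>2 * t\<close> and
  \<open>d - 1 = 2 * m\<close>, the common power contributes \<open>2 powr m\<close>.\<close>

lemma measure_cap_asymp:
  fixes q :: "real ^ 'd"
  assumes q: "norm q = 1"
  defines "m \<equiv> (real CARD('d) - 1) / 2"
  obtains \<kappa> where "\<kappa> > 0"
    "((\<lambda>t. measure sphere_measure {x. 1 - q \<bullet> x \<le> t} / t powr m) \<longlongrightarrow> \<kappa>) (at_right 0)"
proof -
  let ?d = "CARD('d)"
  define V where "V = measure lborel (solid_cone q 1 1)"
  have V: "V > 0" unfolding V_def using measure_solid_cone_pos[OF q] .
  define \<tau> where "\<tau> t = sqrt (1 / (1 - t)\<^sup>2 - 1)" for t :: real
  let ?S = "\<lambda>t. measure sphere_measure {x. 1 - q \<bullet> x \<le> t}"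
  have ev: "\<forall>\<^sub>F t in at_right (0::real). 0 < t \<and> t < 1"
    unfolding eventually_at_right_field by (intro exI[of _ 1]) auto
  have quot: "((\<lambda>t. \<tau> t ^ (?d - 1) / t powr m) \<longlongrightarrow> 2 powr m) (at_right 0)"
  proof -
    have "((\<lambda>t::real. (1 / (1 - t)\<^sup>2 - 1) / t) \<longlongrightarrow> 2) (at_right 0)" by real_asymp
    then have "((\<lambda>t::real. ((1 / (1 - t)\<^sup>2 - 1) / t) powr m) \<longlongrightarrow> 2 powr m) (at_right 0)"
      by (intro tendsto_powr) auto
    then show ?thesis
    proof (rule Lim_transform_eventually)
      show "\<forall>\<^sub>F t in at_right 0. ((1 / (1 - t)\<^sup>2 - 1) / t) powr m = \<tau> t ^ (?d - 1) / t powr m"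
        using ev
      proof eventually_elim
        case (elim t)
        then have "(1 - t)\<^sup>2 < 1" by (simp add: power_less_one_iff abs_square_less_1)
        then have pos: "1 / (1 - t)\<^sup>2 - 1 > 0" using elim by (simp add: field_simps)
        have "\<tau> t ^ (?d - 1) = \<tau> t powr real (?d - 1)"
          using pos by (subst powr_realpow) (auto simp: \<tau>_def)
        also have "\<dots> = ((1 / (1 - t)\<^sup>2 - 1) powr (1 / 2)) powr real (?d - 1)"
          using pos by (simp add: \<tau>_def powr_half_sqrt)
        also have "\<dots> = (1 / (1 - t)\<^sup>2 - 1) powr m"
          unfolding powr_powr by (simp add: m_def of_nat_diff Suc_leI)
        finally show ?case using elim pos by (simp add: powr_divide)
      qed
    qed
  qed
  have "((\<lambda>t. ?S t / t powr m) \<longlongrightarrow> ?d * 2 powr m * V) (at_right 0)"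
  proof (rule tendsto_sandwich)
    have "((\<lambda>t::real. real ?d * (1 - t) ^ ?d * (\<tau> t ^ (?d - 1) / t powr m) * V) \<longlongrightarrow> real ?d * (1 - 0) ^ ?d * 2 powr m * V) (at_right 0)"
      by (intro tendsto_intros quot)
    then show "((\<lambda>t::real. real ?d * (1 - t) ^ ?d * (\<tau> t ^ (?d - 1) / t powr m) * V) \<longlongrightarrow> ?d * 2 powr m * V) (at_right 0)"
      by simp
    show "((\<lambda>t::real. real ?d * (\<tau> t ^ (?d - 1) / t powr m) * V) \<longlongrightarrow> ?d * 2 powr m * V) (at_right 0)"
      by (intro tendsto_intros quot)
    show "\<forall>\<^sub>F t in at_right (0::real). real ?d * (1 - t) ^ ?d * (\<tau> t ^ (?d - 1) / t powr m) * V \<le> ?S t / t powr m"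
      using ev
    proof eventually_elim
      case (elim t)
      then show ?case
        using divide_right_mono[OF measure_cap_bounds(2)[OF q, of t], of "t powr m"]
        by (simp add: V_def \<tau>_def)
    qed
    show "\<forall>\<^sub>F t in at_right 0. ?S t / t powr m \<le> real ?d * (\<tau> t ^ (?d - 1) / t powr m) * V"
      using ev
    proof eventually_elim
      case (elim t)
      then show ?case
        using divide_right_mono[OF measure_cap_bounds(1)[OF q, of t], of "t powr m"]
        by (simp add: V_def \<tau>_def)
    qed
  qed
  moreover have "?d * 2 powr m * V > 0" using V by simp
  ultimately show ?thesis using that by blast
qed

section \<open>Attention weights\<close>

lemma continuous_on_C2_on: "C2_on S f \<Longrightarrow> continuous_on S f"
proof -
  assume "C2_on S f"
  then obtain U g g' where U: "S \<subseteq> U" "\<forall>x\<in>S. g x = f x"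
    "\<forall>x\<in>U. (g has_derivative blinfun_apply (g' x)) (at x)"
    unfolding C2_on_def by blast
  have "continuous_on S g"
  proof (intro continuous_at_imp_continuous_on ballI)
    fix x assume "x \<in> S"
    with U show "isCont g x" using has_derivative_continuous by blast
  qed
  then show ?thesis using U(2) by (simp cong: continuous_on_cong)
qed

text \<open>The caps shrink to \<open>q\<close>, so by continuity the density on them is nearly the
  constant \<open>\<rho> q\<close>, and the limit is that of the surface measure multiplied by
  \<open>\<rho> q\<close>.\<close>

lemma measure_cap_density_asymp:
  fixes q :: "real ^ 'd" and \<rho> :: "real ^ 'd \<Rightarrow> real"
  assumes q: "norm q = 1"
    and rho_meas [measurable]: "\<rho> \<in> borel_measurable borel"
    and rho_cont: "continuous_on (sphere 0 1) \<rho>"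
    and rho_q: "\<rho> q > 0"
  defines "m \<equiv> (real CARD('d) - 1) / 2"
  obtains c where "c > 0"
    "((\<lambda>t. measure (density sphere_measure (\<lambda>x. ennreal (\<rho> x))) {x. 1 - q \<bullet> x \<le> t} / t powr m)
       \<longlongrightarrow> c) (at_right 0)"
proof -
  define S where "S t = measure sphere_measure {x. 1 - q \<bullet> x \<le> t}" for t
  define F where "F t = measure (density sphere_measure (\<lambda>x. ennreal (\<rho> x))) {x. 1 - q \<bullet> x \<le> t}" for t
  interpret \<sigma>: finite_measure "sphere_measure :: (real ^ 'd) measure"
    by (rule finite_sphere_measure)
  obtain \<kappa> where \<kappa>: "\<kappa> > 0" "((\<lambda>t. S t / t powr m) \<longlongrightarrow> \<kappa>) (at_right 0)"
    unfolding S_def m_def using measure_cap_asymp[OF q] by blast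
  have "\<forall>\<^sub>F t in at_right 0. S t / t powr m > 0"
    using \<kappa> by (intro order_tendstoD) auto
  then have S_pos: "\<forall>\<^sub>F t in at_right 0. S t > 0"
    by (rule eventually_mono) (auto simp: S_def zero_less_divide_iff)
  have ratio: "((\<lambda>t. F t / S t) \<longlongrightarrow> \<rho> q) (at_right 0)"
  proof (rule tendstoI)
    fix e :: real assume "e > 0"
    \<comment> \<open>Strictly below \<open>e\<close>, to pass from a weak to a strict inequality,
      and at most \<open>\<rho> q\<close>, so that \<open>\<rho> q - e'\<close> remains nonnegative
      inside \<open>ennreal\<close>.\<close>
    define e' where "e' = min (e / 2) (\<rho> q)"
    have e': "e' > 0" "e' < e" "e' \<le> \<rho> q" using \<open>e > 0\<close> rho_q by (auto simp: e'_def)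
    obtain \<delta> where \<delta>: "\<delta> > 0" "\<And>x. x \<in> sphere 0 1 \<Longrightarrow> dist x q < \<delta> \<Longrightarrow> dist (\<rho> x) (\<rho> q) < e'"
      using rho_cont q e'(1) unfolding continuous_on_iff by (metis mem_sphere_0)
    \<comment> \<open>On the unit sphere the squared distance from \<open>x\<close> to
      \<open>q\<close> equals \<open>2 * (1 - q \<bullet> x)\<close>.\<close>
    have "\<forall>\<^sub>F t in at_right (0::real). t < \<delta>\<^sup>2 / 2"
      using \<delta> unfolding eventually_at_right_field by (intro exI[of _ "\<delta>\<^sup>2 / 2"]) auto
    with S_pos show "\<forall>\<^sub>F t in at_right 0. dist (F t / S t) (\<rho> q) < e"
    proof eventually_elim
      case (elim t)
      have near: "\<bar>\<rho> x - \<rho> q\<bar> \<le> e'" if x: "x \<in> sphere 0 1" "1 - q \<bullet> x \<le> t" for x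
      proof -
        have "(dist x q)\<^sup>2 = 2 * (1 - q \<bullet> x)"
          using q x(1) by (simp add: dist_norm power2_norm_eq_inner inner_diff_left inner_diff_right
              inner_commute norm_eq_1)
        also have "\<dots> < \<delta>\<^sup>2" using x(2) elim by simp
        finally have "dist x q < \<delta>" using \<delta>(1) by (simp add: power_less_imp_less_base)
        then show ?thesis using \<delta>(2)[OF x(1)] by (simp add: dist_real_def)
      qed
      let ?C = "{x. 1 - q \<bullet> x \<le> t}"
      have C [measurable]: "?C \<in> sets borel" by measurable
      have F_eq: "emeasure (density sphere_measure (\<lambda>x. ennreal (\<rho> x))) ?C
          = (\<integral>\<^sup>+x. ennreal (\<rho> x) * indicator ?C x \<partial>sphere_measure)"
        by (subst emeasure_density) auto
      also have "\<dots> \<le> (\<integral>\<^sup>+x. ennreal (\<rho> q + e') * indicator ?C x \<partial>sphere_measure)"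
      proof (intro nn_integral_mono_AE, use AE_sphere_measure in eventually_elim)
        case (elim x)
        then show ?case
          using near[of x] by (auto simp: indicator_def abs_le_iff intro!: ennreal_leI)
      qed
      also have "\<dots> = ennreal ((\<rho> q + e') * S t)"
        using rho_q e' by (subst nn_integral_cmult_indicator)
          (auto simp: \<sigma>.emeasure_eq_measure S_def ennreal_mult)
      finally have upper: "emeasure (density sphere_measure (\<lambda>x. ennreal (\<rho> x))) ?C \<le> ennreal ((\<rho> q + e') * S t)" .
      have "ennreal ((\<rho> q - e') * S t) = (\<integral>\<^sup>+x. ennreal (\<rho> q - e') * indicator ?C x \<partial>sphere_measure)"
        using e' by (subst nn_integral_cmult_indicator)
          (auto simp: \<sigma>.emeasure_eq_measure S_def ennreal_mult)
      also have "\<dots> \<le> (\<integral>\<^sup>+x. ennreal (\<rho> x) * indicator ?C x \<partial>sphere_measure)"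
      proof (intro nn_integral_mono_AE, use AE_sphere_measure in eventually_elim)
        case (elim x)
        then show ?case
          using near[of x] by (auto simp: indicator_def abs_le_iff intro!: ennreal_leI)
      qed
      finally have lower: "ennreal ((\<rho> q - e') * S t) \<le> emeasure (density sphere_measure (\<lambda>x. ennreal (\<rho> x))) ?C"
        by (simp add: F_eq)
      have "emeasure (density sphere_measure (\<lambda>x. ennreal (\<rho> x))) ?C = ennreal (F t)"
        unfolding F_def using upper by (intro emeasure_eq_ennreal_measure) (auto simp: top_unique)
      moreover have "F t \<ge> 0" "(\<rho> q + e') * S t \<ge> 0"
        using e' rho_q elim by (simp_all add: F_def)
      ultimately have "F t \<le> (\<rho> q + e') * S t" "(\<rho> q - e') * S t \<le> F t"
        using upper lower by (simp_all only: ennreal_le_iff)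
      then have "\<bar>F t / S t - \<rho> q\<bar> \<le> e'"
        using elim by (simp add: abs_le_iff field_simps)
      then show ?case using e'(2) by (simp add: dist_real_def)
    qed
  qed
  have "((\<lambda>t. F t / S t * (S t / t powr m)) \<longlongrightarrow> \<rho> q * \<kappa>) (at_right 0)"
    by (intro tendsto_mult ratio \<kappa>)
  then have "((\<lambda>t. F t / t powr m) \<longlongrightarrow> \<rho> q * \<kappa>) (at_right 0)"
    by (rule Lim_transform_eventually) (use S_pos in \<open>auto elim!: eventually_mono\<close>)
  moreover have "\<rho> q * \<kappa> > 0" using rho_q \<kappa> by simp
  ultimately show ?thesis using that unfolding F_def by blast
qed

text \<open>The first entry of the decreasing list is at least \<open>x\<close>, and together with
  any other entry it sums to at most \<open>1\<close>, leaving at most \<open>\<epsilon>\<close> for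
  that other entry.\<close>

lemma rev_sort_dominant:
  fixes xs :: "real list"
  assumes nonneg: "\<And>x. x \<in> set xs \<Longrightarrow> x \<ge> 0" and sum: "sum_list xs = 1"
    and x: "x \<in> set xs" "x \<ge> 1 - \<epsilon>"
  shows "\<bar>rev (sort xs) ! 0 - 1\<bar> \<le> \<epsilon>"
    and "\<lbrakk>0 < i; i < length xs\<rbrakk> \<Longrightarrow> \<bar>rev (sort xs) ! i\<bar> \<le> \<epsilon>"
proof -
  define ys where "ys = rev (sort xs)"
  have len: "length ys = length xs" and set: "set ys = set xs"
    by (simp_all add: ys_def)
  have "mset ys = mset xs" by (simp add: ys_def)
  then have "sum_list ys = 1" using sum by (metis sum_mset_sum_list)
  then have sum_ys: "(\<Sum>i<length xs. ys ! i) = 1"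
    by (simp add: sum_list_sum_nth len atLeast0LessThan)
  have ys_nonneg: "ys ! i \<ge> 0" if "i < length xs" for i
    using that nonneg set len by (metis nth_mem)
  have pos: "0 < length xs" using x by (auto intro: length_pos_if_in_set)
  obtain j where j: "j < length xs" "ys ! j = x" using x(1) set len by (metis in_set_conv_nth)
  have "ys ! j \<le> ys ! 0"
  proof -
    have "sort xs ! (length xs - 1 - j) \<le> sort xs ! (length xs - 1)"
      using j by (intro sorted_nth_mono) auto
    then show ?thesis using j pos by (simp add: ys_def rev_nth)
  qed
  then have top: "ys ! 0 \<ge> 1 - \<epsilon>" using j x by simp
  have "ys ! 0 \<le> 1"
    using member_le_sum[of 0 "{..<length xs}" "\<lambda>i. ys ! i"] pos ys_nonneg sum_ys by auto
  then show "\<bar>rev (sort xs) ! 0 - 1\<bar> \<le> \<epsilon>"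
    using top by (simp add: ys_def)
  assume i: "0 < i" "i < length xs"
  have "(\<Sum>j\<in>{0, i}. ys ! j) \<le> (\<Sum>j<length xs. ys ! j)"
    using i ys_nonneg by (intro sum_mono2) auto
  then have "ys ! i \<le> \<epsilon>" using i top sum_ys by simp
  then show "\<bar>rev (sort xs) ! i\<bar> \<le> \<epsilon>"
    using ys_nonneg[OF i(2)] by (simp add: ys_def)
qed

text \<open>Factoring the \<open>k\<close>-th exponential out of \<open>Zval\<close> gives
  \<open>1 / (1 + R)\<close> for the \<open>k\<close>-th weight, where \<open>R\<close> is the sum
  in the hypothesis, and this is at least \<open>1 - R\<close>.\<close>

lemma Aord_dominant:
  assumes k: "k \<in> {1..n}"
    and small: "(\<Sum>j\<in>{1..n}-{k}. exp (- (\<beta> n * (Tval q X j \<omega> - Tval q X k \<omega>)))) < \<epsilon>"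
  shows "\<bar>Aord \<beta> q X n 1 \<omega> - 1\<bar> \<le> \<epsilon>"
    and "\<lbrakk>2 \<le> i; i \<le> n\<rbrakk> \<Longrightarrow> \<bar>Aord \<beta> q X n i \<omega>\<bar> \<le> \<epsilon>"
proof -
  define E where "E j = exp (- \<beta> n * Tval q X j \<omega>)" for j
  define R where "R = (\<Sum>j\<in>{1..n}-{k}. exp (- (\<beta> n * (Tval q X j \<omega> - Tval q X k \<omega>))))"
  have R: "R < \<epsilon>" "R \<ge> 0" using small by (auto simp: R_def intro: sum_nonneg)
  have E: "E j > 0" for j by (simp add: E_def)
  have "Zval \<beta> q X n \<omega> = E k + (\<Sum>j\<in>{1..n}-{k}. E j)"
    unfolding Zval_def E_def using k by (subst sum.remove[of _ k]) auto
  also have "(\<Sum>j\<in>{1..n}-{k}. E j) = E k * R"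
    unfolding R_def sum_distrib_left E_def exp_add[symmetric] by (intro sum.cong) (auto simp: algebra_simps)
  finally have Z: "Zval \<beta> q X n \<omega> = E k * (1 + R)" by (simp add: algebra_simps)
  have Z_pos: "Zval \<beta> q X n \<omega> > 0" unfolding Z using E R by (simp add: add_pos_nonneg)
  have A_k: "Aval \<beta> q X n k \<omega> \<ge> 1 - \<epsilon>"
  proof -
    have "Aval \<beta> q X n k \<omega> = 1 / (1 + R)"
      using E[of k] unfolding Aval_def Z E_def[symmetric] by simp
    moreover have "(1 - R) * (1 + R) \<le> 1" by (simp add: algebra_simps)
    then have "1 - R \<le> 1 / (1 + R)" using R by (simp add: pos_le_divide_eq)
    ultimately show ?thesis using R by linarith
  qed
  let ?xs = "map (\<lambda>j. Aval \<beta> q X n j \<omega>) [1..<n+1]"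
  have nonneg: "x \<ge> 0" if "x \<in> set ?xs" for x
    using that Z_pos by (auto simp: Aval_def)
  have "sum_list ?xs = (\<Sum>j=1..n. Aval \<beta> q X n j \<omega>)"
    by (simp add: interv_sum_list_conv_sum_set_nat atLeastLessThanSuc_atLeastAtMost del: upt_Suc)
  also have "\<dots> = 1"
    using Z_pos unfolding Aval_def Zval_def by (simp flip: sum_divide_distrib)
  finally have sum: "sum_list ?xs = 1" .
  have mem: "Aval \<beta> q X n k \<omega> \<in> set ?xs"
    using k by (simp add: less_Suc_eq_le del: upt_Suc)
  show "\<bar>Aord \<beta> q X n 1 \<omega> - 1\<bar> \<le> \<epsilon>"
    using rev_sort_dominant(1)[OF nonneg sum mem A_k] by (simp add: Aord_def)
  show "\<bar>Aord \<beta> q X n i \<omega>\<bar> \<le> \<epsilon>" if "2 \<le> i" "i \<le> n"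
    using rev_sort_dominant(2)[OF nonneg sum mem A_k, of "i - 1"] that by (simp add: Aord_def)
qed

text \<open>An exceptional event \<open>B\<close> avoids a measurability proof for the order
  statistics: monotonicity of the measure asks only that the larger set be measurable.\<close>

lemma (in prob_space) conv_in_probI:
  assumes "\<And>\<epsilon> \<delta>. \<lbrakk>\<epsilon> > 0; \<delta> > 0\<rbrakk> \<Longrightarrow>
    \<forall>\<^sub>F n in sequentially. \<exists>B\<in>events. prob B \<le> \<delta> \<and> (\<forall>\<omega>\<in>space M - B. \<bar>Y n \<omega> - c\<bar> \<le> \<epsilon>)"
  shows "conv_in_prob M Y c"
  unfolding conv_in_prob_def
proof (intro allI impI tendstoI)
  fix \<epsilon> e :: real assume "\<epsilon> > 0" "e > 0"
  then have "\<forall>\<^sub>F n in sequentially. \<exists>B\<in>events. prob B \<le> e / 2 \<and> (\<forall>\<omega>\<in>space M - B. \<bar>Y n \<omega> - c\<bar> \<le> \<epsilon>)"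
    by (intro assms) auto
  then show "\<forall>\<^sub>F n in sequentially. dist (prob {\<omega> \<in> space M. \<bar>Y n \<omega> - c\<bar> > \<epsilon>}) 0 < e"
  proof eventually_elim
    case (elim n)
    then obtain B where B: "B \<in> events" "prob B \<le> e / 2" "\<forall>\<omega>\<in>space M - B. \<bar>Y n \<omega> - c\<bar> \<le> \<epsilon>"
      by blast
    have "prob {\<omega> \<in> space M. \<bar>Y n \<omega> - c\<bar> > \<epsilon>} \<le> prob B"
      using B by (intro finite_measure_mono) (auto simp: not_le[symmetric])
    then show ?case using B(2) \<open>e > 0\<close> by (simp add: dist_real_def)
  qed
qed

theorem mainTheorem1:
  fixes M :: "'m measure"
    and X :: "nat \<Rightarrow> 'm \<Rightarrow> real ^ 'd"
    and q :: "real ^ 'd"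
    and \<rho> :: "real ^ 'd \<Rightarrow> real"
    and \<beta> :: "nat \<Rightarrow> real"
  assumes "prob_space M"
    and dim: "CARD('d) \<ge> 2"
    and q: "q \<in> sphere 0 1"
    and rho_nonneg: "\<forall>x\<in>sphere 0 1. \<rho> x \<ge> 0"
    and rho_meas: "\<rho> \<in> borel_measurable borel"
    and rho_prob: "(\<integral>\<^sup>+ x. ennreal (\<rho> x) \<partial>sphere_measure) = 1"
    and rho_C2: "C2_on (sphere 0 1) \<rho>"
    and rho_q: "\<rho> q > 0"
    and X_meas: "\<forall>i\<ge>1. X i \<in> borel_measurable M"
    and X_indep: "prob_space.indep_vars M (\<lambda>_. borel) X {1..}"
    and X_law: "\<forall>i\<ge>1. distr M borel (X i) = density sphere_measure (\<lambda>x. ennreal (\<rho> x))"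
    and beta_pos: "\<forall>n\<ge>1. \<beta> n > 0"
    and beta_lim: "filterlim (\<lambda>n. \<beta> n * real n powr (- (2 / (real CARD('d) - 1)))) at_top sequentially"
  shows "conv_in_prob M (\<lambda>n. Aord \<beta> q X n 1) 1
         \<and> (\<forall>i::nat. i \<ge> 2 \<longrightarrow> conv_in_prob M (\<lambda>n. Aord \<beta> q X n i) 0)"
proof -
  interpret prob_space M by fact
  define m where "m = (real CARD('d) - 1) / 2"
  define \<mu> where "\<mu> = density sphere_measure (\<lambda>x. ennreal (\<rho> x))"
  define N where "N = distr \<mu> borel (\<lambda>x. 1 - q \<bullet> x)"
  have sets_\<mu> [measurable_cong]: "sets \<mu> = sets borel" by (simp add: \<mu>_def)
  have T_law: "distr M borel (Tval q X i) = N" if "i \<ge> 1" for i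
  proof -
    have [measurable]: "X i \<in> borel_measurable M" using X_meas that by simp
    have "N = distr (distr M borel (X i)) borel (\<lambda>x. 1 - q \<bullet> x)"
      using X_law that by (simp add: N_def \<mu>_def)
    then show ?thesis by (simp add: distr_distr comp_def Tval_def[abs_def])
  qed
  have T_rv: "random_variable borel (Tval q X 1)"
  proof -
    have [measurable]: "X 1 \<in> borel_measurable M" by (rule X_meas[rule_format]) simp
    show ?thesis unfolding Tval_def[abs_def] by measurable
  qed
  interpret N: real_distribution N
    unfolding T_law[of 1, simplified, symmetric]
    using real_distribution_distr[OF T_rv] by simp
  have cdf_N: "cdf N t = measure \<mu> {x. 1 - q \<bullet> x \<le> t}" for t
  proof -
    have "space \<mu> = UNIV" using sets_eq_imp_space_eq[OF sets_\<mu>] by simp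
    then show ?thesis
      unfolding cdf_def N_def by (subst measure_distr) (auto intro!: arg_cong[where f = "measure \<mu>"])
  qed
  obtain c where c: "c > 0" "((\<lambda>t. cdf N t / t powr m) \<longlongrightarrow> c) (at_right 0)"
    unfolding cdf_N \<mu>_def m_def
    using measure_cap_density_asymp[of q \<rho>] q rho_meas continuous_on_C2_on[OF rho_C2] rho_q
    by auto
  have "power_law_at_zero N m c"
    using c dim by unfold_locales (auto simp: m_def)
  moreover have "indep_vars (\<lambda>_. borel) (Tval q X) {1..}"
    using indep_vars_compose2[OF X_indep, of "\<lambda>_ x. 1 - q \<bullet> x" "\<lambda>_. borel"]
    by (simp add: Tval_def[abs_def])
  moreover have "filterlim (\<lambda>n. \<beta> n * real n powr (- (1 / m))) at_top sequentially"
    using beta_lim by (simp add: m_def)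
  ultimately have dominant: "\<forall>\<^sub>F n in sequentially. \<exists>B\<in>events. prob B \<le> 3 * (\<delta> / 3) \<and>
      (\<forall>\<omega>\<in>space M - B. \<exists>k\<in>{1..n}. (\<Sum>j\<in>{1..n}-{k}. exp (- (\<beta> n * (Tval q X j \<omega> - Tval q X k \<omega>)))) < \<epsilon>)"
    if "\<epsilon> > 0" "\<delta> > 0" for \<epsilon> \<delta>
    using that beta_pos T_law
    by (intro power_law_single_dominant_term) auto
  \<comment> \<open>Both claims reduce to a deterministic implication for each outcome; probability
    enters only through \<open>dominant\<close>.\<close>
  have conv: "conv_in_prob M Y y"
    if Y: "\<And>\<epsilon>. \<forall>\<^sub>F n in sequentially. \<forall>\<omega>. \<forall>k\<in>{1..n}.
      (\<Sum>j\<in>{1..n}-{k}. exp (- (\<beta> n * (Tval q X j \<omega> - Tval q X k \<omega>)))) < \<epsilon> \<longrightarrow> \<bar>Y n \<omega> - y\<bar> \<le> \<epsilon>" for Y y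
  proof (rule conv_in_probI)
    fix \<epsilon> \<delta> :: real assume "\<epsilon> > 0" "\<delta> > 0"
    from dominant[OF this] Y[of \<epsilon>]
    show "\<forall>\<^sub>F n in sequentially. \<exists>B\<in>events. prob B \<le> \<delta> \<and> (\<forall>\<omega>\<in>space M - B. \<bar>Y n \<omega> - y\<bar> \<le> \<epsilon>)"
    proof eventually_elim
      case (elim n)
      from elim(1) obtain B where "B \<in> events" "prob B \<le> 3 * (\<delta> / 3)"
        "\<forall>\<omega>\<in>space M - B. \<exists>k\<in>{1..n}. (\<Sum>j\<in>{1..n}-{k}. exp (- (\<beta> n * (Tval q X j \<omega> - Tval q X k \<omega>)))) < \<epsilon>"
        by blast
      with elim(2) show ?case by (intro bexI[of _ B]) (simp, blast)
    qed
  qed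
  show ?thesis
  proof (intro conjI allI impI conv)
    fix \<epsilon>
    show "\<forall>\<^sub>F n in sequentially. \<forall>\<omega>. \<forall>k\<in>{1..n}.
        (\<Sum>j\<in>{1..n}-{k}. exp (- (\<beta> n * (Tval q X j \<omega> - Tval q X k \<omega>)))) < \<epsilon> \<longrightarrow> \<bar>Aord \<beta> q X n 1 \<omega> - 1\<bar> \<le> \<epsilon>"
      by (intro always_eventually allI ballI impI) (rule Aord_dominant(1))
  next
    fix i :: nat and \<epsilon> assume i: "i \<ge> 2"
    show "\<forall>\<^sub>F n in sequentially. \<forall>\<omega>. \<forall>k\<in>{1..n}.
        (\<Sum>j\<in>{1..n}-{k}. exp (- (\<beta> n * (Tval q X j \<omega> - Tval q X k \<omega>)))) < \<epsilon> \<longrightarrow> \<bar>Aord \<beta> q X n i \<omega> - 0\<bar> \<le> \<epsilon>"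
      \<comment> \<open>For \<open>n < i\<close> the position \<open>i - 1\<close> is out of range
        in \<open>Aord\<close>, so the bound is asserted only once \<open>n\<close> reaches
        \<open>i\<close>.\<close>
      using eventually_ge_at_top[of i]
    proof eventually_elim
      case (elim n)
      show ?case
      proof (intro allI ballI impI)
        fix \<omega> k
        assume "k \<in> {1..n}"
          "(\<Sum>j\<in>{1..n}-{k}. exp (- (\<beta> n * (Tval q X j \<omega> - Tval q X k \<omega>)))) < \<epsilon>"
        from Aord_dominant(2)[where \<beta> = \<beta>, OF this i elim] show "\<bar>Aord \<beta> q X n i \<omega> - 0\<bar> \<le> \<epsilon>"
          by simp
      qed
    qed
  qed
qed

end
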